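(* Let $f:\Omega\to\mathbb{H}$ be a function. The following assertions are equivalent. \begin{itemize} \item[(a)] $f\in\mathcal{SR}(\Omega,\mathbb{H})$, i.e., $f$ is slice regular. \item[(b)] $f\in\mathscr{C}^0(\Omega,\mathbb{H})$, $f_*\in\mathscr{C}^1(\Omega_*,\mathbb{H})$ and $f_*\in\ker(\overline{\vartheta})$. \item[(c)] $f\in\mathscr{C}^1(\Omega,\mathbb{H})$ and $f_*\in\ker(\overline{\vartheta})$. \item[(d)] $f\in\mathscr{C}^1(\Omega,\mathbb{H})$ and $f\in\ker(G)$. \item[(e)] $f\in\mathcal{S}^1(\Omega,\mathbb{H})$ and $\frac{\partial f}{\partial x^c}=0$ on $\Omega$. \end{itemize}
   Context: $\mathbb{H}$ is the real algebra of quaternions, with the Euclidean topology and real analytic structure of $\mathbb{R}^4$. $\mathbb{S}_{\mathbb{H}}=\{I\in\mathbb{H}:I^2=-1\}$ and, for $I\in\mathbb{S}_{\mathbb{H}}$, $\mathbb{C}_I=\{\alpha+I\beta:\alpha,\beta\in\mathbb{R}\}$. A subset of $\mathbb{H}$ is circular if it has the form $\Omega_E=\{\alpha+I\beta:\alpha,\beta\in\mathbb{R},\ \alpha+i\beta\in E,\ I\in\mathbb{S}_{\mathbb{H}}\}$ for some $E\subset\mathbb{C}$. Fixed throughout: $\Omega$ is a non-empty connected circular open subset of $\mathbb{H}$ with $\Omega\cap\mathbb{R}\neq\emptyset$, and $D\subset\mathbb{C}$ is the (non-empty, connected, open, conjugation-invariant) set with $\Omega=\Omega_D$, i.e. $D=\{\alpha+i\beta:\alpha+I\beta\in\Omega\text{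 for all }I\in\mathbb{S}_{\mathbb{H}}\}$. Put $\Omega_I=\Omega\cap\mathbb{C}_I$, $\phi_I:D\to\Omega_I$, $\phi_I(\alpha+i\beta)=\alpha+I\beta$; $f_I=f|_{\Omega_I}$; $\Omega_*=\Omega\setminus\mathbb{R}$, $f_*=f|_{\Omega_*}$. For an open set $O\subset\mathbb{H}$, $\mathscr{C}^0(O,\mathbb{H})$ and $\mathscr{C}^1(O,\mathbb{H})$ are the sets of continuous, respectively $\mathscr{C}^1$ (in the real sense), functions $O\to\mathbb{H}$. If $g:\Omega_I\to\mathbb{H}$ is such that $g\circ\phi_I$ is $\mathscr{C}^1$, then $\overline{\partial}_I g(x)=\frac12\Big(\big(\frac{\partial}{\partial\alpha}+I\frac{\partial}{\partial\beta}\big)(g\circ\phi_I)\Big)(\phi_I^{-1}(x))$. The function $f$ is slice regular if $f\in\mathscr{C}^1(\Omega,\mathbb{H})$ and $\overline{\partial}_I f_I=0$ on $\Omega_I$ for all $I\in\mathbb{S}_{\mathbb{H}}$; $\mathcal{SR}(\Omega,\mathbb{H})$ is the set of such functions. Write $x=x_0+x_1i+x_2j+x_3k\in\mathbb{H}$ with $x_h\in\mathbb{R}$, and $\mathrm{Im}(x)=x_1i+x_2j+x_3k$. The operators $\overline{\vartheta}:\mathscr{C}^1(\Omega_*,\mathbb{H})\to\mathscr{C}^0(\Omega_*,\mathbb{H})$ and $G:\mathscr{C}^1(\Omega,\mathbb{H})\to\mathscr{C}^0(\Omega,\mathbb{H})$ are $$\overline{\vartheta}=\frac12\Big(\frac{\partial}{\partial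 x_0}+\frac{\mathrm{Im}(x)}{|\mathrm{Im}(x)|^2}\sum_{h=1}^3x_h\frac{\partial}{\partial x_h}\Big),\qquad G=|\mathrm{Im}(x)|^2\frac{\partial}{\partial x_0}+\mathrm{Im}(x)\sum_{h=1}^3x_h\frac{\partial}{\partial x_h}$$ (quaternionic factors multiply on the left). A stem function is $F=F_1+iF_2:D\to\mathbb{H}\otimes_{\mathbb{R}}\mathbb{C}$ ($F_1,F_2:D\to\mathbb{H}$, $i$ the imaginary unit of the factor $\mathbb{C}$) with $F_1(\overline z)=F_1(z)$, $F_2(\overline z)=-F_2(z)$. It induces the slice function $f=\mathcal{I}(F):\Omega\to\mathbb{H}$, $f(\alpha+I\beta)=F_1(\alpha+i\beta)+IF_2(\alpha+i\beta)$ for all $\alpha+i\beta\in D$, $I\in\mathbb{S}_{\mathbb{H}}$; $F$ is uniquely determined by $f$. $\mathcal{S}^1(\Omega,\mathbb{H})$ is the set of slice functions induced by stem functions with $F_1,F_2$ of class $\mathscr{C}^1$. For $f=\mathcal{I}(F)\in\mathcal{S}^1(\Omega,\mathbb{H})$, $\frac{\partial f}{\partial x^c}=\mathcal{I}\big(\frac{\partial F}{\partial\overline z}\big)$, where $\frac{\partial F}{\partial\overline z}=\frac12\Big(\big(\frac{\partial F_1}{\partial\alpha}-\frac{\partial F_2}{\partial\beta}\big)+i\big(\frac{\partial F_1}{\partial\beta}+\frac{\partial F_2}{\partial\alpha}\big)\Big)$ (again a stem function). *)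

theory Defs
  imports "HOL-Analysis.Analysis"
begin

section \<open>Quaternions\<close>

datatype quat = Quat (qc0: real) (qc1: real) (qc2: real) (qc3: real)

lemma quat_eq_iff: "x = y \<longleftrightarrow> qc0 x = qc0 y \<and> qc1 x = qc1 y \<and> qc2 x = qc2 y \<and> qc3 x = qc3 y"
  by (cases x; cases y) auto

instantiation quat :: ab_group_add
begin

definition zero_quat where "0 = Quat 0 0 0 0"
definition plus_quat where
  "x + y = Quat (qc0 x + qc0 y) (qc1 x + qc1 y) (qc2 x + qc2 y) (qc3 x + qc3 y)"
definition minus_quat where
  "x - y = Quat (qc0 x - qc0 y) (qc1 x - qc1 y) (qc2 x - qc2 y) (qc3 x - qc3 y)"
definition uminus_quat where
  "- x = Quat (- qc0 x) (- qc1 x) (- qc2 x) (- qc3 x)"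

instance
  by standard (simp_all add: quat_eq_iff zero_quat_def plus_quat_def minus_quat_def uminus_quat_def)

end

lemma quat_zero_simps [simp]: "qc0 0 = 0" "qc1 0 = 0" "qc2 0 = 0" "qc3 0 = 0"
  and quat_plus_simps [simp]:
    "qc0 (x + y) = qc0 x + qc0 y" "qc1 (x + y) = qc1 x + qc1 y"
    "qc2 (x + y) = qc2 x + qc2 y" "qc3 (x + y) = qc3 x + qc3 y"
  and quat_minus_simps [simp]:
    "qc0 (x - y) = qc0 x - qc0 y" "qc1 (x - y) = qc1 x - qc1 y"
    "qc2 (x - y) = qc2 x - qc2 y" "qc3 (x - y) = qc3 x - qc3 y"
  and quat_uminus_simps [simp]:
    "qc0 (- x) = - qc0 x" "qc1 (- x) = - qc1 x" "qc2 (- x) = - qc2 x" "qc3 (- x) = - qc3 x"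
  by (simp_all add: zero_quat_def plus_quat_def minus_quat_def uminus_quat_def)

instantiation quat :: ring_1
begin

definition one_quat where "1 = Quat 1 0 0 0"
definition times_quat where
  "x * y = Quat
    (qc0 x * qc0 y - qc1 x * qc1 y - qc2 x * qc2 y - qc3 x * qc3 y)
    (qc0 x * qc1 y + qc1 x * qc0 y + qc2 x * qc3 y - qc3 x * qc2 y)
    (qc0 x * qc2 y - qc1 x * qc3 y + qc2 x * qc0 y + qc3 x * qc1 y)
    (qc0 x * qc3 y + qc1 x * qc2 y - qc2 x * qc1 y + qc3 x * qc0 y)"

instance
  by standard (simp_all add: quat_eq_iff one_quat_def times_quat_def algebra_simps)

end

lemma quat_one_simps [simp]: "qc0 1 = 1" "qc1 1 = 0" "qc2 1 = 0" "qc3 1 = 0"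
  by (simp_all add: one_quat_def)

lemma quat_times_simps [simp]:
  "qc0 (x * y) = qc0 x * qc0 y - qc1 x * qc1 y - qc2 x * qc2 y - qc3 x * qc3 y"
  "qc1 (x * y) = qc0 x * qc1 y + qc1 x * qc0 y + qc2 x * qc3 y - qc3 x * qc2 y"
  "qc2 (x * y) = qc0 x * qc2 y - qc1 x * qc3 y + qc2 x * qc0 y + qc3 x * qc1 y"
  "qc3 (x * y) = qc0 x * qc3 y + qc1 x * qc2 y - qc2 x * qc1 y + qc3 x * qc0 y"
  by (simp_all add: times_quat_def)

instantiation quat :: real_algebra_1
begin

definition scaleR_quat where
  "r *\<^sub>R x = Quat (r * qc0 x) (r * qc1 x) (r * qc2 x) (r * qc3 x)"

instance
  by standard (simp_all add: quat_eq_iff scaleR_quat_def algebra_simps)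

end

lemma quat_scaleR_simps [simp]:
  "qc0 (r *\<^sub>R x) = r * qc0 x" "qc1 (r *\<^sub>R x) = r * qc1 x"
  "qc2 (r *\<^sub>R x) = r * qc2 x" "qc3 (r *\<^sub>R x) = r * qc3 x"
  by (simp_all add: scaleR_quat_def)

lemma quat_of_real_simps [simp]:
  "qc0 (of_real r) = r" "qc1 (of_real r) = 0" "qc2 (of_real r) = 0" "qc3 (of_real r) = 0"
  by (simp_all add: of_real_def)

instantiation quat :: real_inner
begin

definition inner_quat where
  "x \<bullet> y = qc0 x * qc0 y + qc1 x * qc1 y + qc2 x * qc2 y + qc3 x * qc3 y"
definition norm_quat where
  "norm (x :: quat) = sqrt (x \<bullet> x)"
definition sgn_quat where
  "sgn (x :: quat) = x /\<^sub>R norm x"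
definition dist_quat where
  "dist (x :: quat) y = norm (x - y)"
definition uniformity_quat where
  "(uniformity :: (quat \<times> quat) filter) = (INF e\<in>{0 <..}. principal {(x, y). dist x y < e})"
definition open_quat where
  "open (U :: quat set) \<longleftrightarrow> (\<forall>x\<in>U. eventually (\<lambda>(x', y). x' = x \<longrightarrow> y \<in> U) uniformity)"

instance
proof
  fix x y z :: quat and r :: real and U :: "quat set"
  show "dist x y = norm (x - y)"
    by (rule dist_quat_def)
  show "sgn x = x /\<^sub>R norm x"
    by (rule sgn_quat_def)
  show "(uniformity :: (quat \<times> quat) filter) = (INF e\<in>{0 <..}. principal {(x, y). dist x y < e})"
    by (rule uniformity_quat_def)
  show "open U \<longleftrightarrow> (\<forall>x\<in>U. \<forall>\<^sub>F (x', y) in uniformity. x' = x \<longrightarrow> y \<in> U)"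
    by (rule open_quat_def)
  show "x \<bullet> y = y \<bullet> x" "(x + y) \<bullet> z = x \<bullet> z + y \<bullet> z" "(r *\<^sub>R x) \<bullet> y = r * (x \<bullet> y)"
    by (simp_all add: inner_quat_def algebra_simps)
  show "0 \<le> x \<bullet> x" "x \<bullet> x = 0 \<longleftrightarrow> x = 0"
    by (simp_all add: inner_quat_def quat_eq_iff add_nonneg_eq_0_iff)
  show "norm x = sqrt (x \<bullet> x)"
    by (rule norm_quat_def)
qed

end

definition qi :: quat where "qi = Quat 0 1 0 0"
definition qj :: quat where "qj = Quat 0 0 1 0"
definition qk :: quat where "qk = Quat 0 0 0 1"

lemma quat_unit_simps [simp]:
  "qc0 qi = 0" "qc1 qi = 1" "qc2 qi = 0" "qc3 qi = 0"
  "qc0 qj = 0" "qc1 qj = 0" "qc2 qj = 1" "qc3 qj = 0"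
  "qc0 qk = 0" "qc1 qk = 0" "qc2 qk = 0" "qc3 qk = 1"
  by (simp_all add: qi_def qj_def qk_def)

lemma quat_unit_mult:
  "qi * qi = -1" "qj * qj = -1" "qk * qk = -1"
  "qi * qj = qk" "qj * qk = qi" "qk * qi = qj"
  "qj * qi = - qk" "qk * qj = - qi" "qi * qk = - qj"
  by (simp_all add: quat_eq_iff)

instantiation quat :: euclidean_space
begin

definition Basis_quat where "Basis = {1, qi, qj, qk}"

instance
proof
  fix u v :: quat
  show "(Basis :: quat set) \<noteq> {}" "finite (Basis :: quat set)"
    by (simp_all add: Basis_quat_def)
  have "1 \<noteq> qi" "1 \<noteq> qj" "1 \<noteq> qk" "qi \<noteq> qj" "qi \<noteq> qk" "qj \<noteq> qk"
    by (simp_all add: quat_eq_iff)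
  moreover assume "u \<in> Basis" "v \<in> Basis"
  ultimately show "u \<bullet> v = (if u = v then 1 else 0)"
    unfolding Basis_quat_def by (elim insertE emptyE; simp add: inner_quat_def)
next
  fix x :: quat
  show "(\<forall>u\<in>Basis. x \<bullet> u = 0) \<longleftrightarrow> x = 0"
    by (simp add: Basis_quat_def inner_quat_def quat_eq_iff [of x 0])
qed

end

instantiation quat :: real_normed_div_algebra
begin

definition inverse_quat where
  "inverse x = Quat (qc0 x) (- qc1 x) (- qc2 x) (- qc3 x) /\<^sub>R (x \<bullet> x)"
definition divide_quat where
  "x div (y :: quat) = x * inverse y"

instance
proof
  fix x y :: quat
  show "norm (x * y) = norm x * norm y"
    unfolding norm_quat_def real_sqrt_mult [symmetric]
    by (simp add: inner_quat_def algebra_simps)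
  assume "x \<noteq> 0"
  then have nz: "x \<bullet> x \<noteq> 0" by simp
  then have *: "inverse (x \<bullet> x) * (qc0 x * qc0 x + qc1 x * qc1 x + qc2 x * qc2 x + qc3 x * qc3 x) = 1"
    by (simp add: inner_quat_def)
  show "inverse x * x = 1" "x * inverse x = 1"
    using * by (simp_all add: quat_eq_iff inverse_quat_def algebra_simps)
qed (simp_all add: divide_quat_def inverse_quat_def quat_eq_iff)

end

definition quat_Im :: "quat \<Rightarrow> quat" where
  "quat_Im x = qc1 x *\<^sub>R qi + qc2 x *\<^sub>R qj + qc3 x *\<^sub>R qk"


section \<open>Circular sets\<close>

definition imag_units :: "quat set" where
  "imag_units = {I. I ^ 2 = -1}"

definition slice_embed :: "quat \<Rightarrow> complex \<Rightarrow> quat" where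
  "slice_embed I z = of_real (Re z) + I * of_real (Im z)"

definition slice_plane :: "quat \<Rightarrow> quat set" where
  "slice_plane I = range (slice_embed I)"

definition circularization :: "complex set \<Rightarrow> quat set" where
  "circularization E = {slice_embed I z | I z. I \<in> imag_units \<and> z \<in> E}"

definition circular :: "quat set \<Rightarrow> bool" where
  "circular \<Omega> \<longleftrightarrow> (\<exists>E. \<Omega> = circularization E)"

definition stem_domain :: "quat set \<Rightarrow> complex set" where
  "stem_domain \<Omega> = {z. \<forall>I\<in>imag_units. slice_embed I z \<in> \<Omega>}"


section \<open>Differentiability and differential operators\<close>

text \<open>Real differentiability class C1 on a (tacitly open) set.\<close>

definition C1_on :: "('a::real_normed_vector \<Rightarrow> 'b::real_normed_vector) \<Rightarrow> 'a set \<Rightarrow> bool" where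
  "C1_on f S \<longleftrightarrow>
    (\<exists>f' :: 'a \<Rightarrow> 'a \<Rightarrow>\<^sub>L 'b.
      (\<forall>x\<in>S. (f has_derivative blinfun_apply (f' x)) (at x)) \<and> continuous_on S f')"

definition partial :: "'a::real_normed_vector \<Rightarrow> ('a \<Rightarrow> 'b::real_normed_vector) \<Rightarrow> 'a \<Rightarrow> 'b" where
  "partial v f x = vector_derivative (\<lambda>t. f (x + t *\<^sub>R v)) (at 0)"

text \<open>
  Functions on a subset are rendered as total functions; the operators below only use the
  values near the point of evaluation. In \<open>dbar\<close> these are values in the slice plane
  \<open>\<complex>\<^sub>I\<close> only, so that \<open>dbar D I f\<close> depends only on \<open>f\<close>
  restricted to that plane.
\<close>

definition dbar :: "complex set \<Rightarrow> quat \<Rightarrow> (quat \<Rightarrow> quat) \<Rightarrow> quat \<Rightarrow> quat" where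
  "dbar D I g x =
    (let z = inv_into D (slice_embed I) x; h = g \<circ> slice_embed I
     in (1/2) *\<^sub>R (partial 1 h z + I * partial \<i> h z))"

definition slice_regular :: "quat set \<Rightarrow> (quat \<Rightarrow> quat) \<Rightarrow> bool" where
  "slice_regular \<Omega> f \<longleftrightarrow> C1_on f \<Omega> \<and>
    (\<forall>I\<in>imag_units. \<forall>x \<in> \<Omega> \<inter> slice_plane I. dbar (stem_domain \<Omega>) I f x = 0)"

definition euler_sum :: "(quat \<Rightarrow> quat) \<Rightarrow> quat \<Rightarrow> quat" where
  "euler_sum f x = qc1 x *\<^sub>R partial qi f x + qc2 x *\<^sub>R partial qj f x + qc3 x *\<^sub>R partial qk f x"

definition theta_bar :: "(quat \<Rightarrow> quat) \<Rightarrow> quat \<Rightarrow> quat" where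
  "theta_bar f x =
    (1/2) *\<^sub>R (partial 1 f x + (quat_Im x /\<^sub>R (norm (quat_Im x))\<^sup>2) * euler_sum f x)"

definition G_op :: "(quat \<Rightarrow> quat) \<Rightarrow> quat \<Rightarrow> quat" where
  "G_op f x = (norm (quat_Im x))\<^sup>2 *\<^sub>R partial 1 f x + quat_Im x * euler_sum f x"


section \<open>Stem functions and slice functions\<close>

text \<open>
  An element \<open>a + i b\<close> of the complexified algebra \<open>\<bbbH> \<otimes> \<complex>\<close> is encoded as the pair
  \<open>(a, b)\<close>, so \<open>F\<^sub>1 = fst \<circ> F\<close> and \<open>F\<^sub>2 = snd \<circ> F\<close>.
\<close>

definition stem_function :: "complex set \<Rightarrow> (complex \<Rightarrow> quat \<times> quat) \<Rightarrow> bool" where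
  "stem_function D F \<longleftrightarrow>
    (\<forall>z\<in>D. fst (F (cnj z)) = fst (F z) \<and> snd (F (cnj z)) = - snd (F z))"

text \<open>
  The value does not depend on the chosen representation of the point, and \<open>THE\<close> is
  justified, by \<open>slice_fun_slice_embed\<close> below.
\<close>

definition slice_fun :: "complex set \<Rightarrow> (complex \<Rightarrow> quat \<times> quat) \<Rightarrow> quat \<Rightarrow> quat" where
  "slice_fun D F x =
    (THE w. \<forall>I\<in>imag_units. \<forall>z\<in>D. x = slice_embed I z \<longrightarrow> w = fst (F z) + I * snd (F z))"

definition induces :: "quat set \<Rightarrow> (complex \<Rightarrow> quat \<times> quat) \<Rightarrow> (quat \<Rightarrow> quat) \<Rightarrow> bool" where
  "induces \<Omega> F f \<longleftrightarrow> stem_function (stem_domain \<Omega>) F \<and>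
    (\<forall>x\<in>\<Omega>. f x = slice_fun (stem_domain \<Omega>) F x)"

definition slice_C1 :: "quat set \<Rightarrow> (quat \<Rightarrow> quat) \<Rightarrow> bool" where
  "slice_C1 \<Omega> f \<longleftrightarrow> (\<exists>F. induces \<Omega> F f \<and>
    C1_on (fst \<circ> F) (stem_domain \<Omega>) \<and> C1_on (snd \<circ> F) (stem_domain \<Omega>))"

definition stem_dzbar :: "(complex \<Rightarrow> quat \<times> quat) \<Rightarrow> complex \<Rightarrow> quat \<times> quat" where
  "stem_dzbar F z =
    ((1/2) *\<^sub>R (partial 1 (fst \<circ> F) z - partial \<i> (snd \<circ> F) z),
     (1/2) *\<^sub>R (partial \<i> (fst \<circ> F) z + partial 1 (snd \<circ> F) z))"

text \<open>The inducing stem function is unique on the domain, see \<open>induces_unique\<close> below.\<close>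

definition slice_dxc :: "quat set \<Rightarrow> (quat \<Rightarrow> quat) \<Rightarrow> quat \<Rightarrow> quat" where
  "slice_dxc \<Omega> f = slice_fun (stem_domain \<Omega>) (stem_dzbar (SOME F. induces \<Omega> F f))"


section \<open>Well-definedness\<close>

lemma imag_units_iff:
  "I \<in> imag_units \<longleftrightarrow> qc0 I = 0 \<and> qc1 I ^ 2 + qc2 I ^ 2 + qc3 I ^ 2 = 1"
proof
  assume "I \<in> imag_units"
  then have *: "qc0 I * qc0 I - qc1 I * qc1 I - qc2 I * qc2 I - qc3 I * qc3 I = -1"
    "qc0 I * qc1 I = 0" "qc0 I * qc2 I = 0" "qc0 I * qc3 I = 0"
    by (auto simp: imag_units_def power2_eq_square quat_eq_iff)
  have "qc0 I = 0"
  proof (rule ccontr)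
    assume "qc0 I \<noteq> 0"
    with * have "qc0 I * qc0 I = -1" by simp
    then show False using zero_le_square [of "qc0 I"] by linarith
  qed
  with * show "qc0 I = 0 \<and> qc1 I ^ 2 + qc2 I ^ 2 + qc3 I ^ 2 = 1"
    by (simp add: power2_eq_square)
qed (simp add: imag_units_def power2_eq_square quat_eq_iff)

lemma qi_imag_unit: "qi \<in> imag_units"
  by (simp add: imag_units_iff)

lemma imag_units_uminus: "I \<in> imag_units \<Longrightarrow> - I \<in> imag_units"
  by (simp add: imag_units_iff)

lemma slice_embed_cnj: "slice_embed I (cnj z) = slice_embed (- I) z"
  by (simp add: slice_embed_def)

lemma slice_embed_eqD:
  assumes I: "I \<in> imag_units" and J: "J \<in> imag_units"
    and eq: "slice_embed I z = slice_embed J w"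
  shows "w = z \<and> (I = J \<or> Im z = 0) \<or> w = cnj z \<and> J = - I"
proof -
  have re: "Re z = Re w"
    and im: "qc1 I * Im z = qc1 J * Im w" "qc2 I * Im z = qc2 J * Im w" "qc3 I * Im z = qc3 J * Im w"
    using eq I J by (auto simp: slice_embed_def quat_eq_iff imag_units_iff)
  have "(qc1 I ^ 2 + qc2 I ^ 2 + qc3 I ^ 2) * Im z ^ 2 = (qc1 J ^ 2 + qc2 J ^ 2 + qc3 J ^ 2) * Im w ^ 2"
    by (simp only: distrib_right power_mult_distrib [symmetric] im)
  then have "Im z ^ 2 = Im w ^ 2"
    using I J by (simp add: imag_units_iff)
  then consider "Im w = Im z" | "Im w = - Im z" "Im z \<noteq> 0"
    by (metis power2_eq_iff minus_zero)
  then show ?thesis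
  proof cases
    case 1
    then have "w = z" using re by (simp add: complex_eq_iff)
    moreover have "I = J" if "Im z \<noteq> 0"
      using that 1 im I J by (simp add: quat_eq_iff imag_units_iff)
    ultimately show ?thesis by blast
  next
    case 2
    have "w = cnj z" using re 2(1) by (simp add: complex_eq_iff)
    moreover have "qc1 I = - qc1 J" "qc2 I = - qc2 J" "qc3 I = - qc3 J"
      using im 2(2) unfolding 2(1) minus_mult_commute [symmetric] mult_cancel_right by blast+
    then have "J = - I" using I J by (simp add: quat_eq_iff imag_units_iff)
    ultimately show ?thesis by blast
  qed
qed

lemma inj_slice_embed: "I \<in> imag_units \<Longrightarrow> inj (slice_embed I)"
  by (rule injI)
    (auto simp: slice_embed_def quat_eq_iff imag_units_iff complex_eq_iff)

lemma circular_stem_domain: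
  assumes "circular \<Omega>"
  shows "circularization (stem_domain \<Omega>) = \<Omega>"
proof -
  obtain E where E: "\<Omega> = circularization E"
    using assms by (auto simp: circular_def)
  then have "E \<subseteq> stem_domain \<Omega>"
    by (auto simp: stem_domain_def circularization_def)
  then show ?thesis
    using E by (fastforce simp: stem_domain_def circularization_def)
qed

lemma cnj_stem_domain: "z \<in> stem_domain \<Omega> \<Longrightarrow> cnj z \<in> stem_domain \<Omega>"
  by (simp add: stem_domain_def slice_embed_cnj imag_units_uminus)

lemma slice_fun_slice_embed:
  assumes F: "stem_function D F" and I: "I \<in> imag_units" and z: "z \<in> D"
  shows "slice_fun D F (slice_embed I z) = fst (F z) + I * snd (F z)"
  unfolding slice_fun_def
proof (rule the_equality)
  show "\<forall>J\<in>imag_units. \<forall>w\<in>D. slice_embed I z = slice_embed J w \<longrightarrow>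
    fst (F z) + I * snd (F z) = fst (F w) + J * snd (F w)"
  proof (intro ballI impI)
    fix J w assume J: "J \<in> imag_units" and w: "w \<in> D" and eq: "slice_embed I z = slice_embed J w"
    have *: "fst (F (cnj z)) = fst (F z)" "snd (F (cnj z)) = - snd (F z)"
      using F z by (auto simp: stem_function_def)
    have real: "snd (F z) = 0" if "Im z = 0"
    proof -
      have "cnj z = z" using that by (simp add: complex_eq_iff)
      then show ?thesis using *(2) by (simp add: quat_eq_iff)
    qed
    show "fst (F z) + I * snd (F z) = fst (F w) + J * snd (F w)"
      using slice_embed_eqD [OF I J eq] real * by auto
  qed
qed (use I z in blast)

lemma induces_iff:
  assumes "circular \<Omega>"
  shows "induces \<Omega> F f \<longleftrightarrow> stem_function (stem_domain \<Omega>) F \<and>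
    (\<forall>z\<in>stem_domain \<Omega>. \<forall>I\<in>imag_units. f (slice_embed I z) = fst (F z) + I * snd (F z))"
proof -
  have *: "slice_embed I z \<in> \<Omega>" if "I \<in> imag_units" "z \<in> stem_domain \<Omega>" for I z
    using that by (simp add: stem_domain_def)
  have **: "\<exists>I\<in>imag_units. \<exists>z\<in>stem_domain \<Omega>. x = slice_embed I z" if "x \<in> \<Omega>" for x
    using that circular_stem_domain [OF assms] by (force simp: circularization_def)
  show ?thesis
    unfolding induces_def
    by (metis * ** slice_fun_slice_embed)
qed

lemma induces_unique:
  assumes "circular \<Omega>" "induces \<Omega> F f" "induces \<Omega> H f" "z \<in> stem_domain \<Omega>"
  shows "F z = H z"
proof -
  have eq: "fst (F z) + I * snd (F z) = fst (H z) + I * snd (H z)" if "I \<in> imag_units" for I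
    using assms that by (simp add: induces_iff)
  have *: "fst (F z) + qi * snd (F z) = fst (H z) + qi * snd (H z)"
    "fst (F z) - qi * snd (F z) = fst (H z) - qi * snd (H z)"
    using eq [OF qi_imag_unit] eq [OF imag_units_uminus [OF qi_imag_unit]] by simp_all
  have "fst (F z) = fst (H z)" "snd (F z) = snd (H z)"
    using * by (auto simp: quat_eq_iff)
  then show ?thesis by (rule prod_eqI)
qed

end

theory Submission
  imports Defs "HOL-Complex_Analysis.Complex_Analysis"
begin

text \<open>
  The operators \<^const>\<open>theta_bar\<close>, \<^const>\<open>G_op\<close> and \<^const>\<open>dbar\<close> are one operator in three
  guises. At a point \<open>\<alpha> + I \<beta>\<close> with \<open>\<beta> \<noteq> 0\<close> the radial sum \<open>\<Sum> x\<^sub>h \<partial>/\<partial>x\<^sub>h\<close> is \<open>\<beta>\<close> times the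
  derivative in the direction \<open>I\<close>, so \<open>theta_bar f = (\<partial>\<^sub>1 f + I \<partial>\<^sub>I f) / 2\<close>: this is the
  Cauchy-Riemann operator of the restriction of \<open>f\<close> to \<open>\<complex>\<^sub>I\<close> (\<open>theta_bar_slice_embed\<close>,
  \<open>dbar_slice_embed\<close>). Moreover \<open>G_op\<close> is a nonzero real multiple of \<open>theta_bar\<close> off the real axis
  and vanishes on it. So slice regularity implies the other two conditions on \<open>C\<^sup>1\<close> functions, these
  are equivalent to each other, and they imply the condition that asks only for continuity at real
  points. Two implications have content: from that weakest condition to the one on stem functions,
  and from there back to slice regularity.

  From continuity and \<open>theta_bar f = 0\<close> to the stem function: on each slice, \<open>f\<close> satisfies the
  Cauchy-Riemann equation off the real axis. The quaternions are a complex vector space for left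
  multiplication by \<open>I\<close>, and in complex coordinates (\<open>left_coord\<close>) the equation says that \<open>f\<close> is an
  ordinary holomorphic function off the axis. By Morera's theorem the axis is removable
  (\<open>slice_holomorphicI\<close>). Every two slices share the real points of the domain, and the stem domain
  is connected and meets the real axis, so the identity theorem expresses the values on one slice
  through those on any other one (\<open>representation_formula\<close>). This formula exhibits \<open>f\<close> as a slice
  function, whose stem function is smooth because it is built from one holomorphic slice
  (\<open>slice_holomorphic_imp_stem\<close>).

  From the stem function to slice regularity: the Cauchy-Riemann equations of the stem function give
  those of each slice at once; what has to be shown is that \<open>f\<close> is continuously differentiable at
  real points, where the angular part \<open>Im x / \<bar>Im x\<bar>\<close> is discontinuous (\<open>stem_imp_C1_on\<close>). The
  equations make the derivative of \<open>f\<close> at a non-real point \<open>x = \<alpha> + I \<beta>\<close> very simple. On \<open>\<complex>\<^sub>I\<close> it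
  is right multiplication by \<open>S = \<partial>F\<^sub>1/\<partial>\<alpha> + I \<partial>F\<^sub>2/\<partial>\<alpha>\<close>, and on the orthogonal complement of \<open>\<complex>\<^sub>I\<close> it
  is right multiplication by \<open>Q = F\<^sub>2/\<beta>\<close>. So \<open>df\<^sub>x(v) = v Q + P\<^sub>x(v) (S - Q)\<close> with \<open>P\<^sub>x\<close> the projection
  onto \<open>\<complex>\<^sub>I\<close>. Since \<open>F\<^sub>2\<close> vanishes on the real axis, \<open>Q\<close> extends continuously to it by
  \<open>\<partial>F\<^sub>2/\<partial>\<beta> = \<partial>F\<^sub>1/\<partial>\<alpha>\<close>, so \<open>S - Q\<close> tends to \<open>0\<close> there and suppresses the discontinuity of the
  bounded factor \<open>P\<^sub>x\<close>.
\<close>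

section \<open>Slices and real differentiation\<close>

lemma imag_units_square: "I \<in> imag_units \<Longrightarrow> I * I = -1"
  by (simp add: imag_units_def power2_eq_square)

lemma imag_units_mult_left: "I \<in> imag_units \<Longrightarrow> I * (I * q) = - q"
  by (simp add: imag_units_square flip: mult.assoc)

lemma norm_imag_unit: "I \<in> imag_units \<Longrightarrow> norm I = 1"
  by (simp add: imag_units_iff norm_quat_def inner_quat_def power2_eq_square)

lemma linear_slice_embed: "linear (slice_embed I)"
  by (rule linearI) (simp_all add: slice_embed_def quat_eq_iff algebra_simps)

lemma bounded_linear_slice_embed: "bounded_linear (slice_embed I)"
  using linear_slice_embed linear_linear by blast

lemma slice_embed_1 [simp]: "slice_embed I 1 = 1"
  and slice_embed_i [simp]: "slice_embed I \<i> = I"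
  and slice_embed_of_real [simp]: "slice_embed I (of_real t) = of_real t"
  by (simp_all add: slice_embed_def)

lemma linear_quat_Im: "linear quat_Im"
  by (rule linearI) (simp_all add: quat_Im_def quat_eq_iff algebra_simps)

lemma bounded_linear_quat_Im: "bounded_linear quat_Im"
  using linear_quat_Im linear_linear by blast

lemma bounded_linear_qc0: "bounded_linear qc0"
proof -
  have "linear qc0"
    by (rule linearI) simp_all
  then show ?thesis
    by (rule linear_conv_bounded_linear [THEN iffD1])
qed

lemma quat_Im_simps [simp]:
  "qc0 (quat_Im x) = 0" "qc1 (quat_Im x) = qc1 x" "qc2 (quat_Im x) = qc2 x" "qc3 (quat_Im x) = qc3 x"
  by (simp_all add: quat_Im_def)

lemma quat_Im_slice_embed: "I \<in> imag_units \<Longrightarrow> quat_Im (slice_embed I z) = Im z *\<^sub>R I"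
  by (simp add: quat_Im_def slice_embed_def imag_units_iff quat_eq_iff)

lemma qc0_slice_embed: "I \<in> imag_units \<Longrightarrow> qc0 (slice_embed I z) = Re z"
  by (simp add: slice_embed_def imag_units_iff)

lemma quat_Reals_iff: "x \<in> \<real> \<longleftrightarrow> quat_Im x = 0"
proof
  assume "quat_Im x = 0"
  then have "x = of_real (qc0 x)"
    by (simp add: quat_eq_iff)
  then show "x \<in> \<real>"
    by (metis Reals_of_real)
qed (auto simp: Reals_def quat_eq_iff)

lemma slice_embed_Reals_iff: "I \<in> imag_units \<Longrightarrow> slice_embed I z \<in> \<real> \<longleftrightarrow> Im z = 0"
  using norm_imag_unit [of I] by (auto simp: quat_Reals_iff quat_Im_slice_embed)

lemma partial_eq:
  assumes "(f has_derivative D) (at x)"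
  shows "partial v f x = D v"
proof -
  have "((\<lambda>t. x + t *\<^sub>R v) has_derivative (\<lambda>t. t *\<^sub>R v)) (at 0)"
    by (auto intro!: derivative_eq_intros)
  moreover have "(f has_derivative D) (at (x + 0 *\<^sub>R v))"
    using assms by simp
  ultimately have "((\<lambda>t. f (x + t *\<^sub>R v)) has_derivative (\<lambda>t. D (t *\<^sub>R v))) (at 0)"
    by (rule has_derivative_compose)
  moreover have "D (t *\<^sub>R v) = t *\<^sub>R D v" for t
    using assms by (simp add: has_derivative_linear linear_cmul)
  ultimately show ?thesis
    unfolding partial_def by (simp add: vector_derivative_at has_vector_derivative_def)
qed

lemma partial_cong:
  assumes "open S" "x \<in> S" and eq: "\<And>y. y \<in> S \<Longrightarrow> f y = g y"
  shows "partial v f x = partial v g x"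
proof -
  have "open ((\<lambda>t. x + t *\<^sub>R v) -` S)"
    using assms by (intro open_vimage continuous_intros)
  then have "\<forall>\<^sub>F t in nhds 0. t \<in> (\<lambda>t. x + t *\<^sub>R v) -` S"
    using assms by (intro eventually_nhds_in_open) auto
  then show ?thesis
    unfolding partial_def
    by (intro vector_derivative_cong_eq) (auto elim!: eventually_mono intro: eq)
qed

text \<open>
  The domain is finite dimensional, so continuity of the derivative in operator norm can be
  tested one direction at a time.
\<close>

lemma C1_onI:
  fixes f :: "'a::euclidean_space \<Rightarrow> 'b::real_normed_vector"
  assumes der: "\<And>x. x \<in> S \<Longrightarrow> (f has_derivative D x) (at x)"
    and cont: "\<And>v. continuous_on S (\<lambda>x. D x v)"
  shows "C1_on f S"
  unfolding C1_on_def
proof (intro exI conjI ballI)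
  have D: "blinfun_apply (Blinfun (D x)) = D x" if "x \<in> S" for x
    using der [OF that] by (simp add: bounded_linear_Blinfun_apply has_derivative_bounded_linear)
  then show "(f has_derivative blinfun_apply (Blinfun (D x))) (at x)" if "x \<in> S" for x
    using der that by simp
  show "continuous_on S (\<lambda>x. Blinfun (D x))"
    by (rule continuous_on_blinfun_componentwise)
      (use cont D in \<open>simp cong: continuous_on_cong\<close>)
qed

lemma C1_on_derivative:
  assumes "C1_on f S"
  obtains f' where "\<And>x. x \<in> S \<Longrightarrow> (f has_derivative f' x) (at x)"
    and "\<And>v. continuous_on S (\<lambda>x. f' x v)"
proof -
  obtain f' where f': "\<forall>x\<in>S. (f has_derivative blinfun_apply (f' x)) (at x)" "continuous_on S f'"
    using assms unfolding C1_on_def by blast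
  show ?thesis
    by (rule that [of "\<lambda>x. blinfun_apply (f' x)"]) (use f' in \<open>auto intro: continuous_intros\<close>)
qed

lemma C1_on_imp_continuous_on: "C1_on f S \<Longrightarrow> continuous_on S f"
  unfolding C1_on_def
  by (metis continuous_at_imp_continuous_on has_derivative_continuous)

lemma C1_on_subset: "C1_on f S \<Longrightarrow> T \<subseteq> S \<Longrightarrow> C1_on f T"
  unfolding C1_on_def by (meson continuous_on_subset subsetD)

section \<open>Circular domains and the half-plane parameter\<close>

text \<open>
  The two parametrisations of a point on a slice differ by conjugation, which preserves the stem
  domain; so one imaginary unit decides for all of them.
\<close>

lemma slice_embed_in_circular_iff:
  assumes "circular \<Omega>" "I \<in> imag_units"
  shows "slice_embed I z \<in> \<Omega> \<longleftrightarrow> z \<in> stem_domain \<Omega>"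
proof
  assume "slice_embed I z \<in> \<Omega>"
  then obtain J w where J: "J \<in> imag_units" and w: "w \<in> stem_domain \<Omega>"
    and eq: "slice_embed I z = slice_embed J w"
    using circular_stem_domain [OF assms(1)] unfolding circularization_def by blast
  from slice_embed_eqD [OF assms(2) J eq] have "z = w \<or> z = cnj w"
    by auto
  then show "z \<in> stem_domain \<Omega>"
    using w by (auto simp: cnj_stem_domain)
qed (use assms(2) in \<open>simp add: stem_domain_def\<close>)

lemma open_stem_domain:
  assumes "open \<Omega>" "circular \<Omega>"
  shows "open (stem_domain \<Omega>)"
proof -
  have "stem_domain \<Omega> = slice_embed qi -` \<Omega>"
    using slice_embed_in_circular_iff [OF assms(2) qi_imag_unit] by auto
  moreover have "continuous_on UNIV (slice_embed qi)"
    using bounded_linear_slice_embed linear_continuous_on by blast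
  ultimately show ?thesis
    using assms(1) by (simp add: open_vimage)
qed

text \<open>
  The representative of a point in the closed upper half plane, so that \<open>x\<close> lies over
  \<open>slice_param x\<close> in the slice of the direction of its imaginary part. The direction is taken to be
  \<^term>\<open>sgn (quat_Im x)\<close>, which is \<open>0\<close> at real points; there its coefficient, the
  imaginary part of \<open>slice_param x\<close>, is \<open>0\<close> as well.
\<close>

definition slice_param :: "quat \<Rightarrow> complex" where
  "slice_param x = Complex (qc0 x) (norm (quat_Im x))"

lemma slice_param_simps [simp]:
  "Re (slice_param x) = qc0 x" "Im (slice_param x) = norm (quat_Im x)"
  by (simp_all add: slice_param_def)

lemma slice_embed_slice_param: "slice_embed (sgn (quat_Im x)) (slice_param x) = x"
proof (cases "quat_Im x = 0")
  case False
  have "slice_embed (sgn (quat_Im x)) (slice_param x) = of_real (qc0 x) + norm (quat_Im x) *\<^sub>R sgn (quat_Im x)"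
    by (simp add: slice_embed_def of_real_def)
  also have "\<dots> = of_real (qc0 x) + quat_Im x"
    using False by (simp add: sgn_quat_def)
  finally show ?thesis
    by (simp add: quat_eq_iff)
qed (simp add: slice_embed_def quat_eq_iff)

lemma sgn_quat_Im_imag_unit:
  assumes "quat_Im x \<noteq> 0"
  shows "sgn (quat_Im x) \<in> imag_units"
proof -
  have "sgn (quat_Im x) \<bullet> sgn (quat_Im x) = 1"
    using norm_sgn [of "quat_Im x"] assms by (simp add: norm_eq_sqrt_inner)
  moreover have "qc0 (sgn (quat_Im x)) = 0"
    by (simp add: sgn_quat_def)
  ultimately show ?thesis
    by (simp add: imag_units_iff inner_quat_def power2_eq_square)
qed

lemma imag_unit_slice_param:
  obtains I where "I \<in> imag_units" "x = slice_embed I (slice_param x)"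
proof (cases "quat_Im x = 0")
  case True
  then have "x = slice_embed qi (slice_param x)"
    by (simp add: slice_embed_def quat_eq_iff)
  then show ?thesis
    using that qi_imag_unit by blast
next
  case False
  then show ?thesis
    using that sgn_quat_Im_imag_unit slice_embed_slice_param by metis
qed

lemma slice_param_in_stem_domain_iff:
  assumes "circular \<Omega>"
  shows "slice_param x \<in> stem_domain \<Omega> \<longleftrightarrow> x \<in> \<Omega>"
  by (metis assms imag_unit_slice_param slice_embed_in_circular_iff)

lemma slice_param_slice_embed:
  assumes "I \<in> imag_units" "Im z \<ge> 0"
  shows "slice_param (slice_embed I z) = z"
  using assms by (simp add: complex_eq_iff qc0_slice_embed quat_Im_slice_embed norm_imag_unit)

lemma continuous_on_slice_param: "continuous_on S slice_param"
proof -
  have "continuous_on S (\<lambda>x. of_real (qc0 x) + \<i> * of_real (norm (quat_Im x)))"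
    by (intro continuous_intros linear_continuous_on bounded_linear_qc0 bounded_linear_quat_Im)
  moreover have "slice_param x = of_real (qc0 x) + \<i> * of_real (norm (quat_Im x))" for x
    by (simp add: complex_eq_iff)
  ultimately show ?thesis
    by (simp cong: continuous_on_cong)
qed

text \<open>
  The closed upper half of the stem domain is the image of \<open>\<Omega>\<close> under
  \<^const>\<open>slice_param\<close>; it and its mirror image share the real points of \<open>\<Omega>\<close>.
\<close>

lemma connected_stem_domain:
  assumes "connected \<Omega>" "circular \<Omega>" and a: "of_real a \<in> \<Omega>"
  shows "connected (stem_domain \<Omega>)"
proof -
  define U where "U = slice_param ` \<Omega>"
  have U: "connected U"
    unfolding U_def by (intro connected_continuous_image continuous_on_slice_param assms)
  then have U': "connected (cnj ` U)"
    by (intro connected_continuous_image continuous_intros)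
  have "complex_of_real a = slice_param (of_real a)"
    by (simp add: complex_eq_iff quat_Im_def)
  then have aU: "of_real a \<in> U"
    using a U_def by blast
  then have "of_real a \<in> cnj ` U"
    by (metis complex_cnj_complex_of_real imageI)
  with aU U U' have "connected (U \<union> cnj ` U)"
    by (intro connected_Un) auto
  moreover have "stem_domain \<Omega> = U \<union> cnj ` U"
  proof (intro equalityI subsetI)
    fix z assume z: "z \<in> stem_domain \<Omega>"
    have *: "w \<in> U" if "w \<in> stem_domain \<Omega>" "Im w \<ge> 0" for w
      unfolding U_def
      using slice_param_slice_embed [OF qi_imag_unit that(2)]
        slice_embed_in_circular_iff [OF assms(2) qi_imag_unit] that(1)
      by (metis imageI)
    show "z \<in> U \<union> cnj ` U"
    proof (cases "Im z \<ge> 0")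
      case False
      then have "cnj z \<in> U"
        using * z by (simp add: cnj_stem_domain)
      then show ?thesis
        by (metis UnI2 complex_cnj_cnj imageI)
    qed (use * z in simp)
  next
    fix z assume "z \<in> U \<union> cnj ` U"
    then show "z \<in> stem_domain \<Omega>"
      using slice_param_in_stem_domain_iff [OF assms(2)] cnj_stem_domain
      by (auto simp: U_def)
  qed
  ultimately show ?thesis
    by simp
qed

section \<open>Functions holomorphic for left multiplication by an imaginary unit\<close>

text \<open>
  The complex-linear functionals of \<open>\<bbbH>\<close> for the complex structure \<open>q \<mapsto> I q\<close>: the real part is an
  arbitrary real functional \<open>q \<mapsto> q \<bullet> w\<close>, and complex linearity forces the imaginary part. Taking all
  of them avoids the choice of an imaginary unit orthogonal to \<open>I\<close>.
\<close>

definition left_coord :: "quat \<Rightarrow> quat \<Rightarrow> quat \<Rightarrow> complex" where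
  "left_coord I w q = Complex (q \<bullet> w) (- ((I * q) \<bullet> w))"

lemma left_coord_simps [simp]:
  "Re (left_coord I w q) = q \<bullet> w" "Im (left_coord I w q) = - ((I * q) \<bullet> w)"
  by (simp_all add: left_coord_def)

lemma linear_left_coord: "linear (left_coord I w)"
  by (rule linearI) (simp_all add: complex_eq_iff inner_add_left distrib_left)

lemma bounded_linear_left_coord: "bounded_linear (left_coord I w)"
  using linear_left_coord linear_conv_bounded_linear by blast

lemma left_coord_imag_unit_mult:
  "I \<in> imag_units \<Longrightarrow> left_coord I w (I * q) = \<i> * left_coord I w q"
  by (simp add: complex_eq_iff imag_units_mult_left)

lemma left_coord_eqI:
  assumes "\<And>w. left_coord I w p = left_coord I w q"
  shows "p = q"
  by (metis assms left_coord_simps(1) vector_eq_rdot)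

lemma left_coord_uminus: "left_coord (- I) w q = cnj (left_coord I w q)"
  by (simp add: complex_eq_iff)

text \<open>
  The condition says that \<open>q \<mapsto> c q\<close> is complex linear from the structure of \<open>J\<close> to that of \<open>I\<close>, so it
  pulls complex-linear functionals back to such functionals.
\<close>

lemma left_coord_intertwine:
  assumes "I * c = c * J"
  shows "left_coord I w (c * q) = left_coord J (adjoint ((*) c) w) q"
proof -
  have adj: "x \<bullet> adjoint ((*) c) w = (c * x) \<bullet> w" for x
    by (rule adjoint_works) (rule linearI; simp add: distrib_left)
  have "I * (c * q) = c * (J * q)"
    by (simp add: assms flip: mult.assoc)
  then show ?thesis
    by (simp add: complex_eq_iff adj)
qed

definition slice_holomorphic :: "quat \<Rightarrow> complex set \<Rightarrow> (complex \<Rightarrow> quat) \<Rightarrow> bool" where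
  "slice_holomorphic I D h \<longleftrightarrow> (\<forall>w. (\<lambda>z. left_coord I w (h z)) holomorphic_on D)"

lemma slice_holomorphic_add:
  "slice_holomorphic I D g \<Longrightarrow> slice_holomorphic I D h \<Longrightarrow> slice_holomorphic I D (\<lambda>z. g z + h z)"
  by (simp add: slice_holomorphic_def linear_add [OF linear_left_coord] holomorphic_on_add)

lemma slice_holomorphic_diff:
  "slice_holomorphic I D g \<Longrightarrow> slice_holomorphic I D h \<Longrightarrow> slice_holomorphic I D (\<lambda>z. g z - h z)"
  by (simp add: slice_holomorphic_def linear_diff [OF linear_left_coord] holomorphic_on_diff)

lemma slice_holomorphic_mult_left:
  "I * c = c * J \<Longrightarrow> slice_holomorphic J D h \<Longrightarrow> slice_holomorphic I D (\<lambda>z. c * h z)"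
  by (simp add: slice_holomorphic_def left_coord_intertwine [where J = J])

lemma slice_holomorphic_cnj:
  assumes h: "slice_holomorphic I D h" and "open D" and sym: "\<And>z. z \<in> D \<Longrightarrow> cnj z \<in> D"
  shows "slice_holomorphic (- I) D (\<lambda>z. h (cnj z))"
  unfolding slice_holomorphic_def
proof
  fix w
  have "cnj ` D \<subseteq> D"
    using sym by auto
  then have "(\<lambda>z. left_coord I w (h z)) holomorphic_on cnj ` D"
    using h unfolding slice_holomorphic_def by (meson holomorphic_on_subset)
  from holomorphic_on_compose_cnj_cnj [OF this \<open>open D\<close>]
  show "(\<lambda>z. left_coord (- I) w (h (cnj z))) holomorphic_on D"
    by (simp add: o_def left_coord_uminus)
qed

text \<open>
  In coordinates the Cauchy-Riemann equation says that the real derivative is complex linear, hence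
  the coordinates are holomorphic off the real axis. A continuous function that is holomorphic on
  both sides of a line is holomorphic across it (Morera).
\<close>

lemma slice_holomorphicI:
  assumes I: "I \<in> imag_units" and "open D" and cont: "continuous_on D h"
    and der: "\<And>z. z \<in> D \<Longrightarrow> Im z \<noteq> 0 \<Longrightarrow> (h has_derivative h' z) (at z)"
    and CR: "\<And>z. z \<in> D \<Longrightarrow> Im z \<noteq> 0 \<Longrightarrow> h' z \<i> = I * h' z 1"
  shows "slice_holomorphic I D h"
  unfolding slice_holomorphic_def
proof
  fix w
  have field_der: "((\<lambda>z. left_coord I w (h z)) has_field_derivative left_coord I w (h' z 1)) (at z)"
    if z: "z \<in> D" "Im z \<noteq> 0" for z
  proof -
    have "(\<lambda>v. left_coord I w (h' z v)) = (*) (left_coord I w (h' z 1))"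
    proof
      fix v
      have lin: "linear (h' z)"
        using der [OF z] by (rule has_derivative_linear)
      have "v = Re v *\<^sub>R 1 + Im v *\<^sub>R \<i>"
        by (simp add: complex_eq_iff)
      then have "h' z v = h' z (Re v *\<^sub>R 1 + Im v *\<^sub>R \<i>)"
        by (rule arg_cong)
      also have "\<dots> = Re v *\<^sub>R h' z 1 + Im v *\<^sub>R (I * h' z 1)"
        by (simp only: linear_add [OF lin] linear_cmul [OF lin] CR [OF z])
      finally have "left_coord I w (h' z v) = Re v *\<^sub>R left_coord I w (h' z 1)
          + Im v *\<^sub>R (\<i> * left_coord I w (h' z 1))"
        by (simp only: linear_add [OF linear_left_coord] linear_cmul [OF linear_left_coord]
          left_coord_imag_unit_mult [OF I])
      then show "left_coord I w (h' z v) = left_coord I w (h' z 1) * v"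
        by (simp add: complex_eq_iff algebra_simps del: left_coord_simps)
    qed
    moreover have "((\<lambda>z. left_coord I w (h z)) has_derivative (\<lambda>v. left_coord I w (h' z v))) (at z)"
      by (rule bounded_linear.has_derivative [OF bounded_linear_left_coord der [OF z]])
    ultimately show ?thesis
      by (simp add: has_field_derivative_def)
  qed
  have off_axis: "(\<lambda>z. left_coord I w (h z)) holomorphic_on D \<inter> X" if "open X" "X \<subseteq> {z. Im z \<noteq> 0}" for X
  proof -
    have "\<exists>f'. ((\<lambda>z. left_coord I w (h z)) has_field_derivative f') (at z)" if "z \<in> D \<inter> X" for z
      using field_der that \<open>X \<subseteq> _\<close> by blast
    then show ?thesis
      using \<open>open D\<close> \<open>open X\<close> by (simp add: holomorphic_on_open open_Int)
  qed
  show "(\<lambda>z. left_coord I w (h z)) holomorphic_on D"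
  proof (rule holomorphic_on_paste_across_line [where f = "\<lambda>z. left_coord I w (h z)" and d = \<i> and k = 0])
    show "(\<lambda>z. left_coord I w (h z)) holomorphic_on D \<inter> {z. \<i> \<bullet> z < 0}"
      and "(\<lambda>z. left_coord I w (h z)) holomorphic_on D \<inter> {z. 0 < \<i> \<bullet> z}"
      using off_axis [of "{z. Im z < 0}"] off_axis [of "{z. 0 < Im z}"]
      by (simp_all add: inner_complex_def open_halfspace_Im_lt open_halfspace_Im_gt Collect_mono)
    show "continuous_on D (\<lambda>z. left_coord I w (h z))"
      by (rule bounded_linear.continuous_on [OF bounded_linear_left_coord cont])
  qed (use \<open>open D\<close> in auto)
qed

text \<open>
  Conversely, regularity comes back from the coordinates: those with respect to the standard basis recover
  \<open>h\<close> and its derivative, and complex linearity of that derivative is detected by all functionals.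
\<close>

lemma slice_holomorphic_derivative:
  assumes I: "I \<in> imag_units" and "open D" and h: "slice_holomorphic I D h"
  obtains h' where "\<And>z. z \<in> D \<Longrightarrow> (h has_derivative h' z) (at z)"
    and "\<And>v. continuous_on D (\<lambda>z. h' z v)"
    and "\<And>z. z \<in> D \<Longrightarrow> h' z \<i> = I * h' z 1"
proof
  define \<phi> where "\<phi> = (\<lambda>w z. left_coord I w (h z))"
  define h' where "h' z v = (\<Sum>b\<in>Basis. Re (deriv (\<phi> b) z * v) *\<^sub>R b)" for z v
  have hol: "\<phi> w holomorphic_on D" for w
    using h by (simp add: slice_holomorphic_def \<phi>_def)
  have der_\<phi>: "(\<phi> w has_derivative (*) (deriv (\<phi> w) z)) (at z)" if "z \<in> D" for w z
    using holomorphic_derivI [OF hol \<open>open D\<close> that] by (simp add: has_field_derivative_def)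
  have "h z = (\<Sum>b\<in>Basis. Re (\<phi> b z) *\<^sub>R b)" for z
    by (simp add: \<phi>_def euclidean_representation)
  then have h_eq: "h = (\<lambda>z. \<Sum>b\<in>Basis. Re (\<phi> b z) *\<^sub>R b)"
    by blast
  show der: "(h has_derivative h' z) (at z)" if z: "z \<in> D" for z
    unfolding h_eq h'_def
    by (intro has_derivative_sum has_derivative_scaleR_left has_derivative_Re der_\<phi> z)
  show "continuous_on D (\<lambda>z. h' z v)" for v
    unfolding h'_def
    by (intro continuous_intros holomorphic_on_imp_continuous_on holomorphic_deriv hol \<open>open D\<close>)
  show "h' z \<i> = I * h' z 1" if z: "z \<in> D" for z
  proof (rule left_coord_eqI)
    fix w
    have "(\<phi> w has_derivative (\<lambda>v. left_coord I w (h' z v))) (at z)"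
      unfolding \<phi>_def by (rule bounded_linear.has_derivative [OF bounded_linear_left_coord der [OF z]])
    with der_\<phi> [OF z] have "(*) (deriv (\<phi> w) z) = (\<lambda>v. left_coord I w (h' z v))"
      using has_derivative_unique by blast
    then have "left_coord I w (h' z v) = deriv (\<phi> w) z * v" for v
      by metis
    then show "left_coord I w (h' z \<i>) = left_coord I w (I * h' z 1)"
      by (simp add: left_coord_imag_unit_mult [OF I] del: left_coord_simps)
  qed
qed

text \<open>
  A real point of an open set is an accumulation point of its real points, so the identity theorem applies to
  each coordinate.
\<close>

lemma slice_holomorphic_identity:
  assumes h: "slice_holomorphic I D h" and "open D" "connected D" and a: "of_real a \<in> D"
    and zero: "\<And>t. of_real t \<in> D \<Longrightarrow> h (of_real t) = 0" and z: "z \<in> D"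
  shows "h z = 0"
proof (rule left_coord_eqI)
  fix w
  have "left_coord I w (h z) = 0"
  proof (rule analytic_continuation [where f = "\<lambda>z. left_coord I w (h z)" and w = z and S = D and U = "D \<inter> \<real>" and \<xi> = "of_real a"])
    show "(\<lambda>z. left_coord I w (h z)) holomorphic_on D"
      using h by (simp add: slice_holomorphic_def)
    show "complex_of_real a islimpt D \<inter> \<real>"
      unfolding islimpt_approachable
    proof (intro allI impI)
      fix e :: real assume "e > 0"
      obtain d where d: "d > 0" "ball (complex_of_real a) d \<subseteq> D"
        using \<open>open D\<close> a by (meson openE)
      define t where "t = min d e / 2"
      have "t > 0" "t < d" "t < e"
        using d \<open>e > 0\<close> by (auto simp: t_def min_def)
      moreover have "dist (complex_of_real (a + t)) (of_real a) = \<bar>t\<bar>"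
        by (simp add: dist_norm)
      ultimately show "\<exists>x'\<in>D \<inter> \<real>. x' \<noteq> complex_of_real a \<and> dist x' (complex_of_real a) < e"
        using d by (intro bexI [of _ "complex_of_real (a + t)"]) (auto simp: dist_commute)
    qed
    show "left_coord I w (h \<zeta>) = 0" if "\<zeta> \<in> D \<inter> \<real>" for \<zeta>
      using that zero linear_0 [OF linear_left_coord] by (auto elim!: Reals_cases)
  qed (use assms in auto)
  then show "left_coord I w (h z) = left_coord I w 0"
    using linear_0 [OF linear_left_coord] by metis
qed

text \<open>
  For fixed \<open>J\<close>, the right-hand side is holomorphic for \<open>I\<close>, because \<open>I (1 - I J) = (1 - I J) J\<close>
  and \<open>I (1 + I J) = (1 + I J) (- J)\<close>. Both sides agree at real \<open>z\<close>, where the two factors add up to \<open>1\<close>.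
\<close>

lemma representation_formula:
  assumes hol: "\<And>I. I \<in> imag_units \<Longrightarrow> slice_holomorphic I D (f \<circ> slice_embed I)"
    and D: "open D" "connected D" "of_real a \<in> D" "\<And>z. z \<in> D \<Longrightarrow> cnj z \<in> D"
    and I: "I \<in> imag_units" and J: "J \<in> imag_units" and z: "z \<in> D"
  shows "f (slice_embed I z) =
    ((1/2) *\<^sub>R (1 - I * J)) * f (slice_embed J z) + ((1/2) *\<^sub>R (1 + I * J)) * f (slice_embed J (cnj z))"
proof -
  define p where "p = (1/2) *\<^sub>R (1 - I * J)"
  define q where "q = (1/2) *\<^sub>R (1 + I * J)"
  define h where "h = f \<circ> slice_embed J"
  define k where "k z = f (slice_embed I z) - (p * h z + q * h (cnj z))" for z
  have hJ: "slice_holomorphic J D h"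
    using hol [OF J] by (simp add: h_def)
  have JJ: "J * J = -1"
    by (rule imag_units_square [OF J])
  have IIJ: "I * (I * J) = - J"
    by (rule imag_units_mult_left [OF I])
  have "slice_holomorphic I D (\<lambda>z. p * h z)"
    by (rule slice_holomorphic_mult_left [OF _ hJ]) (simp add: p_def ring_distribs mult.assoc JJ IIJ)
  moreover have "slice_holomorphic I D (\<lambda>z. q * h (cnj z))"
    by (rule slice_holomorphic_mult_left [OF _ slice_holomorphic_cnj [OF hJ D(1) D(4)]])
      (simp add: q_def ring_distribs mult.assoc JJ IIJ flip: scaleR_minus_right)
  ultimately have "slice_holomorphic I D k"
    using hol [OF I] unfolding k_def o_def
    by (intro slice_holomorphic_diff slice_holomorphic_add)
  moreover have "k (of_real t) = 0" for t
  proof -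
    have "p + q = 1"
      by (simp add: p_def q_def quat_eq_iff field_simps)
    then have "p * f (of_real t) + q * f (of_real t) = f (of_real t)"
      by (metis distrib_right mult_1)
    then show ?thesis
      by (simp add: k_def h_def)
  qed
  ultimately have "k z = 0"
    using slice_holomorphic_identity D z by blast
  then show ?thesis
    by (simp add: k_def p_def q_def h_def)
qed

section \<open>The differential operators along slices\<close>

text \<open>
  The radial sum is the derivative in the direction \<open>Im x = \<beta> I\<close>, and
  \<open>Im x / \<bar>Im x\<bar>\<^sup>2 = I / \<beta>\<close>; the factors \<open>\<beta>\<close> cancel.
\<close>

lemma theta_bar_slice_embed:
  assumes I: "I \<in> imag_units" and "Im z \<noteq> 0"
    and f: "(f has_derivative f') (at (slice_embed I z))"
  shows "theta_bar f (slice_embed I z) = (1/2) *\<^sub>R (f' 1 + I * f' I)"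
proof -
  define x where "x = slice_embed I z"
  have lin: "linear f'"
    using f by (rule has_derivative_linear)
  have Im_x: "quat_Im x = Im z *\<^sub>R I"
    using I by (simp add: x_def quat_Im_slice_embed)
  have "euler_sum f x = f' (quat_Im x)"
    by (simp add: euler_sum_def quat_Im_def partial_eq [OF f [folded x_def]]
      linear_add [OF lin] linear_cmul [OF lin])
  also have "\<dots> = Im z *\<^sub>R f' I"
    by (simp add: Im_x linear_cmul [OF lin])
  finally show ?thesis
    using \<open>Im z \<noteq> 0\<close>
    by (simp add: theta_bar_def partial_eq [OF f [folded x_def]] Im_x norm_imag_unit [OF I]
      power2_eq_square field_simps flip: x_def)
qed

lemma dbar_slice_embed:
  assumes I: "I \<in> imag_units" and z: "z \<in> D"
    and h: "(f \<circ> slice_embed I has_derivative h') (at z)"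
  shows "dbar D I f (slice_embed I z) = (1/2) *\<^sub>R (h' 1 + I * h' \<i>)"
proof -
  have "inj_on (slice_embed I) D"
    using inj_slice_embed [OF I] by (rule inj_on_subset) simp
  then show ?thesis
    by (simp add: dbar_def Let_def z partial_eq [OF h])
qed

lemma has_derivative_slice:
  assumes "(f has_derivative f') (at (slice_embed I z))"
  shows "(f \<circ> slice_embed I has_derivative (\<lambda>v. f' (slice_embed I v))) (at z)"
  using has_derivative_compose [OF bounded_linear_imp_has_derivative [OF bounded_linear_slice_embed] assms]
  by (simp add: o_def)

lemma cauchy_riemann_iff:
  assumes "I \<in> imag_units"
  shows "p + I * q = 0 \<longleftrightarrow> q = I * p"
  by (metis assms add.inverse_inverse add_eq_0_iff imag_units_mult_left mult_minus_right)

lemma G_op_eq_theta_bar: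
  assumes "x \<notin> \<real>"
  shows "G_op f x = (2 * (norm (quat_Im x))\<^sup>2) *\<^sub>R theta_bar f x"
proof -
  have "norm (quat_Im x) \<noteq> 0"
    using assms by (simp add: quat_Reals_iff)
  then show ?thesis
    by (simp add: G_op_def theta_bar_def scaleR_add_right)
qed

lemma G_op_Reals:
  assumes "x \<in> \<real>"
  shows "G_op f x = 0"
  using assms by (simp add: G_op_def quat_Reals_iff)

lemma slice_regular_imp_theta_bar:
  assumes "circular \<Omega>" and f: "slice_regular \<Omega> f" and x: "x \<in> \<Omega> - \<real>"
  shows "theta_bar f x = 0"
proof -
  obtain I z where I: "I \<in> imag_units" and x_eq: "x = slice_embed I z"
    using imag_unit_slice_param by blast
  have z: "z \<in> stem_domain \<Omega>" "Im z \<noteq> 0"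
    using x I by (auto simp: x_eq slice_embed_in_circular_iff [OF \<open>circular \<Omega>\<close>] slice_embed_Reals_iff)
  obtain f' where f': "(f has_derivative f') (at x)"
    using f x by (auto simp: slice_regular_def C1_on_def)
  have "dbar (stem_domain \<Omega>) I f x = 0"
    using f I x by (auto simp: slice_regular_def slice_plane_def x_eq)
  moreover have "theta_bar f x = dbar (stem_domain \<Omega>) I f x"
    using theta_bar_slice_embed [OF I z(2), of f f'] f'
      dbar_slice_embed [OF I z(1) has_derivative_slice, of f f']
    by (simp add: x_eq)
  ultimately show ?thesis
    by simp
qed

lemma theta_bar_imp_slice_holomorphic:
  assumes "open \<Omega>" "circular \<Omega>" and cont: "continuous_on \<Omega> f" and C1: "C1_on f (\<Omega> - \<real>)"
    and ker: "\<forall>x \<in> \<Omega> - \<real>. theta_bar f x = 0" and I: "I \<in> imag_units"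
  shows "slice_holomorphic I (stem_domain \<Omega>) (f \<circ> slice_embed I)"
proof -
  obtain f' where f': "\<And>x. x \<in> \<Omega> - \<real> \<Longrightarrow> (f has_derivative f' x) (at x)"
    using C1_on_derivative [OF C1] by blast
  have *: "slice_embed I z \<in> \<Omega> - \<real>" if "z \<in> stem_domain \<Omega>" "Im z \<noteq> 0" for z
    using that I by (simp add: slice_embed_in_circular_iff [OF \<open>circular \<Omega>\<close>] slice_embed_Reals_iff)
  show ?thesis
  proof (rule slice_holomorphicI [OF I open_stem_domain [OF assms(1,2)],
        where h' = "\<lambda>z v. f' (slice_embed I z) (slice_embed I v)"])
    have "slice_embed I ` stem_domain \<Omega> \<subseteq> \<Omega>"
      using I by (auto simp: stem_domain_def)
    then show "continuous_on (stem_domain \<Omega>) (f \<circ> slice_embed I)"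
      by (intro continuous_on_compose linear_continuous_on bounded_linear_slice_embed
        continuous_on_subset [OF cont])
  next
    fix z assume z: "z \<in> stem_domain \<Omega>" "Im z \<noteq> 0"
    note der = f' [OF * [OF z]]
    show "(f \<circ> slice_embed I has_derivative (\<lambda>v. f' (slice_embed I z) (slice_embed I v))) (at z)"
      by (rule has_derivative_slice [OF der])
    have "f' (slice_embed I z) 1 + I * f' (slice_embed I z) I = 0"
      using theta_bar_slice_embed [OF I z(2) der] ker * [OF z] by simp
    then show "f' (slice_embed I z) (slice_embed I \<i>) = I * f' (slice_embed I z) (slice_embed I 1)"
      using cauchy_riemann_iff [OF I] by simp
  qed
qed

section \<open>Stem functions and their complex derivative\<close>

lemma stem_dzbar_eq:
  assumes "(fst \<circ> F has_derivative d1) (at z)" "(snd \<circ> F has_derivative d2) (at z)"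
  shows "stem_dzbar F z = ((1/2) *\<^sub>R (d1 1 - d2 \<i>), (1/2) *\<^sub>R (d1 \<i> + d2 1))"
  by (simp add: stem_dzbar_def partial_eq [OF assms(1)] partial_eq [OF assms(2)])

text \<open>
  The parity of the components of a stem function is inherited by their derivatives. It is needed
  twice: for \<^const>\<open>stem_dzbar\<close> to be a stem function, and for the derivative along the real axis of
  an odd component to vanish at real points.
\<close>

lemma stem_derivative_cnj:
  assumes "open D" and sym: "\<And>z. z \<in> D \<Longrightarrow> cnj z \<in> D" and z: "z \<in> D"
    and g: "\<And>z. z \<in> D \<Longrightarrow> (g has_derivative g' z) (at z)"
    and eq: "\<And>z. z \<in> D \<Longrightarrow> g (cnj z) = c *\<^sub>R g z"
  shows "g' (cnj z) (cnj v) = c *\<^sub>R g' z v"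
proof -
  have "((\<lambda>z. g (cnj z)) has_derivative (\<lambda>v. g' (cnj z) (cnj v))) (at z)"
    by (rule has_derivative_compose [OF bounded_linear_imp_has_derivative [OF bounded_linear_cnj]
      g [OF sym [OF z]]])
  moreover have "((\<lambda>z. g (cnj z)) has_derivative (\<lambda>v. c *\<^sub>R g' z v)) (at z)"
  proof (rule has_derivative_transform_within_open [OF _ \<open>open D\<close> z])
    show "((\<lambda>z. c *\<^sub>R g z) has_derivative (\<lambda>v. c *\<^sub>R g' z v)) (at z)"
      by (rule has_derivative_scaleR_right [OF g [OF z]])
  qed (simp add: eq)
  ultimately have "(\<lambda>v. g' (cnj z) (cnj v)) = (\<lambda>v. c *\<^sub>R g' z v)"
    by (rule has_derivative_unique)
  then show ?thesis
    by metis
qed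

lemma stem_function_stem_dzbar:
  assumes "open D" and sym: "\<And>z. z \<in> D \<Longrightarrow> cnj z \<in> D" and F: "stem_function D F"
    and C1: "C1_on (fst \<circ> F) D" "C1_on (snd \<circ> F) D"
  shows "stem_function D (stem_dzbar F)"
proof -
  obtain d1 d2 :: "complex \<Rightarrow> complex \<Rightarrow> quat"
    where d1: "\<And>z. z \<in> D \<Longrightarrow> (fst \<circ> F has_derivative d1 z) (at z)"
      and d2: "\<And>z. z \<in> D \<Longrightarrow> (snd \<circ> F has_derivative d2 z) (at z)"
    using C1_on_derivative [OF C1(1)] C1_on_derivative [OF C1(2)] by metis
  have "stem_dzbar F (cnj z) = (fst (stem_dzbar F z), - snd (stem_dzbar F z))" if z: "z \<in> D" for z
  proof -
    have c1: "d1 (cnj z) (cnj v) = 1 *\<^sub>R d1 z v" for v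
      by (rule stem_derivative_cnj [OF \<open>open D\<close> sym z d1])
        (use F in \<open>simp_all add: stem_function_def\<close>)
    have c2: "d2 (cnj z) (cnj v) = (- 1) *\<^sub>R d2 z v" for v
      by (rule stem_derivative_cnj [OF \<open>open D\<close> sym z d2])
        (use F in \<open>simp_all add: stem_function_def\<close>)
    have lin: "linear (d1 (cnj z))" "linear (d2 (cnj z))"
      using d1 d2 sym [OF z] has_derivative_linear by blast+
    have "d1 (cnj z) 1 = d1 z 1" "d2 (cnj z) 1 = - d2 z 1"
      "d1 (cnj z) \<i> = - d1 z \<i>" "d2 (cnj z) \<i> = d2 z \<i>"
      using c1 [of 1] c2 [of 1] c1 [of \<i>] c2 [of \<i>]
      by (simp_all add: linear_neg [OF lin(1)] linear_neg [OF lin(2)] minus_equation_iff)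
    then show ?thesis
      by (simp add: stem_dzbar_eq [OF d1 d2] z sym flip: scaleR_minus_right)
  qed
  then show ?thesis
    by (simp add: stem_function_def)
qed

text \<open>
  The stem function chosen in the definition of \<^const>\<open>slice_dxc\<close> agrees with \<open>F\<close> on the open stem
  domain only; this determines its partial derivatives there.
\<close>

lemma slice_dxc_slice_embed:
  assumes "open \<Omega>" "circular \<Omega>" and F: "induces \<Omega> F f"
    and stem: "stem_function (stem_domain \<Omega>) (stem_dzbar F)"
    and I: "I \<in> imag_units" and z: "z \<in> stem_domain \<Omega>"
  shows "slice_dxc \<Omega> f (slice_embed I z) = fst (stem_dzbar F z) + I * snd (stem_dzbar F z)"
proof -
  define H where "H = (SOME F. induces \<Omega> F f)"
  have H: "induces \<Omega> H f"
    unfolding H_def by (rule someI [of "\<lambda>F. induces \<Omega> F f", OF F])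
  have "stem_dzbar H w = stem_dzbar F w" if w: "w \<in> stem_domain \<Omega>" for w
  proof -
    have "H y = F y" if "y \<in> stem_domain \<Omega>" for y
      by (rule induces_unique [OF \<open>circular \<Omega>\<close> H F that])
    then have "partial v (fst \<circ> H) w = partial v (fst \<circ> F) w"
      "partial v (snd \<circ> H) w = partial v (snd \<circ> F) w" for v
      by (intro partial_cong [OF open_stem_domain [OF assms(1,2)] w]; simp)+
    then show ?thesis
      by (simp add: stem_dzbar_def)
  qed
  moreover from this have "stem_function (stem_domain \<Omega>) (stem_dzbar H)"
    using stem by (simp add: stem_function_def cnj_stem_domain)
  ultimately show ?thesis
    using slice_fun_slice_embed I z unfolding slice_dxc_def H_def [symmetric] by metis
qed

text \<open>
  The values at \<open>\<alpha> + i \<beta>\<close> for the two opposite units \<open>qi\<close> and \<open>- qi\<close> determine both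
  components of \<^const>\<open>stem_dzbar\<close>.
\<close>

lemma slice_dxc_eq_0_iff:
  assumes "open \<Omega>" "circular \<Omega>" and F: "induces \<Omega> F f"
    and C1: "C1_on (fst \<circ> F) (stem_domain \<Omega>)" "C1_on (snd \<circ> F) (stem_domain \<Omega>)"
  shows "(\<forall>x\<in>\<Omega>. slice_dxc \<Omega> f x = 0) \<longleftrightarrow> (\<forall>z\<in>stem_domain \<Omega>. stem_dzbar F z = 0)"
proof -
  have "stem_function (stem_domain \<Omega>) (stem_dzbar F)"
    using F by (intro stem_function_stem_dzbar open_stem_domain assms cnj_stem_domain)
      (simp_all add: induces_def)
  note eq = slice_dxc_slice_embed [OF assms(1-3) this]
  \<comment> \<open>The sum and the difference of the two equations.\<close>
  have *: "p = 0 \<and> q = 0" if "p + qi * q = 0" "p + (- qi) * q = 0" for p q :: quat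
    using that by (simp add: quat_eq_iff)
  show ?thesis
  proof (intro iffI ballI)
    fix z assume ker: "\<forall>x\<in>\<Omega>. slice_dxc \<Omega> f x = 0" and z: "z \<in> stem_domain \<Omega>"
    have "fst (stem_dzbar F z) + I * snd (stem_dzbar F z) = 0" if I: "I \<in> imag_units" for I
      using ker z I eq [OF I z] by (auto simp: stem_domain_def)
    then show "stem_dzbar F z = 0"
      using * qi_imag_unit imag_units_uminus prod_eq_iff fst_zero snd_zero by metis
  next
    fix x assume ker: "\<forall>z\<in>stem_domain \<Omega>. stem_dzbar F z = 0" and x: "x \<in> \<Omega>"
    obtain I where "I \<in> imag_units" "x = slice_embed I (slice_param x)"
      by (rule imag_unit_slice_param)
    moreover have "slice_param x \<in> stem_domain \<Omega>"
      using x by (simp add: slice_param_in_stem_domain_iff [OF assms(2)])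
    ultimately show "slice_dxc \<Omega> f x = 0"
      using eq ker by (metis add_0 fst_zero mult_zero_right snd_zero)
  qed
qed

text \<open>
  The representation formula with \<open>J = qi\<close>, sorted by powers of \<open>I\<close>, reads
  \<open>f (\<alpha> + I \<beta>) = F\<^sub>1 + I F\<^sub>2\<close> with \<open>F\<^sub>1\<close> and \<open>J F\<^sub>2\<close> the even and the odd part of the slice of \<open>f\<close> over \<open>J\<close>.
\<close>

lemma slice_holomorphic_imp_stem:
  assumes "open \<Omega>" "connected \<Omega>" "circular \<Omega>" and a: "of_real a \<in> \<Omega>"
    and hol: "\<And>I. I \<in> imag_units \<Longrightarrow> slice_holomorphic I (stem_domain \<Omega>) (f \<circ> slice_embed I)"
  obtains F where "induces \<Omega> F f" "C1_on (fst \<circ> F) (stem_domain \<Omega>)" "C1_on (snd \<circ> F) (stem_domain \<Omega>)"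
    and "\<And>z. z \<in> stem_domain \<Omega> \<Longrightarrow> stem_dzbar F z = 0"
proof -
  define D where "D = stem_domain \<Omega>"
  define h where "h = f \<circ> slice_embed qi"
  define F where "F z = ((1/2) *\<^sub>R (h z + h (cnj z)), (1/2) *\<^sub>R (qi * (h (cnj z) - h z)))" for z
  have D: "open D" "connected D" "\<And>z. z \<in> D \<Longrightarrow> cnj z \<in> D"
    using assms by (simp_all add: D_def open_stem_domain connected_stem_domain cnj_stem_domain)
  have aD: "of_real a \<in> D"
    using a slice_embed_in_circular_iff [OF \<open>circular \<Omega>\<close> qi_imag_unit, of "of_real a"]
    by (simp add: D_def)
  obtain h' where h': "\<And>z. z \<in> D \<Longrightarrow> (h has_derivative h' z) (at z)"
    and cont: "\<And>v. continuous_on D (\<lambda>z. h' z v)"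
    and CR: "\<And>z. z \<in> D \<Longrightarrow> h' z \<i> = qi * h' z 1"
    using slice_holomorphic_derivative [OF qi_imag_unit D(1)] hol [OF qi_imag_unit]
    unfolding h_def D_def by metis
  have h'_cnj: "((\<lambda>z. h (cnj z)) has_derivative (\<lambda>v. h' (cnj z) (cnj v))) (at z)" if "z \<in> D" for z
    by (rule has_derivative_compose [OF bounded_linear_imp_has_derivative [OF bounded_linear_cnj]
      h' [OF D(3) [OF that]]])
  have cont_cnj: "continuous_on D (\<lambda>z. h' (cnj z) (cnj v))" for v
    by (rule continuous_on_compose2 [OF cont]) (use D(3) in \<open>auto intro: continuous_intros\<close>)
  define d1 where "d1 z v = (1/2) *\<^sub>R (h' z v + h' (cnj z) (cnj v))" for z v
  define d2 where "d2 z v = (1/2) *\<^sub>R (qi * (h' (cnj z) (cnj v) - h' z v))" for z v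
  have d1: "(fst \<circ> F has_derivative d1 z) (at z)" and d2: "(snd \<circ> F has_derivative d2 z) (at z)"
    if "z \<in> D" for z
    unfolding F_def d1_def d2_def o_def fst_conv snd_conv
    by (intro has_derivative_scaleR_right has_derivative_mult_right has_derivative_add
      has_derivative_diff h' h'_cnj that)+
  show ?thesis
  proof
    show "induces \<Omega> F f"
      unfolding induces_iff [OF \<open>circular \<Omega>\<close>]
    proof (intro conjI ballI)
      show "stem_function (stem_domain \<Omega>) F"
        by (simp add: stem_function_def F_def add.commute algebra_simps)
      fix z I assume z: "z \<in> stem_domain \<Omega>" and I: "I \<in> imag_units"
      have "f (slice_embed I z) =
          ((1/2) *\<^sub>R (1 - I * qi)) * h z + ((1/2) *\<^sub>R (1 + I * qi)) * h (cnj z)"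
        using representation_formula [OF _ D(1,2) aD D(3) I qi_imag_unit] hol z
        by (simp add: D_def h_def)
      then show "f (slice_embed I z) = fst (F z) + I * snd (F z)"
        by (simp add: F_def algebra_simps)
    qed
    show "C1_on (fst \<circ> F) (stem_domain \<Omega>)"
      by (rule C1_onI [where D = d1])
        (auto simp: d1_def D_def [symmetric] intro!: d1 continuous_intros cont cont_cnj)
    show "C1_on (snd \<circ> F) (stem_domain \<Omega>)"
      by (rule C1_onI [where D = d2])
        (auto simp: d2_def D_def [symmetric] intro!: d2 continuous_intros cont cont_cnj)
    fix z assume "z \<in> stem_domain \<Omega>"
    then have z: "z \<in> D"
      by (simp add: D_def)
    have "h' (cnj z) (- \<i>) = - (qi * h' (cnj z) 1)"
      using h' [OF D(3) [OF z], THEN has_derivative_linear] by (simp add: linear_neg CR D(3) z)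
    then show "stem_dzbar F z = 0"
      by (simp add: stem_dzbar_eq [OF d1 d2] z zero_prod_def)
        (simp add: d1_def d2_def CR [OF z] algebra_simps imag_units_mult_left [OF qi_imag_unit])
  qed
qed

section \<open>Differentiability across the real axis\<close>

lemma norm_slice_param: "norm (slice_param x) = norm x"
proof -
  have "(norm (quat_Im x))\<^sup>2 = qc1 x ^ 2 + qc2 x ^ 2 + qc3 x ^ 2"
    by (simp only: power2_norm_eq_inner) (simp add: inner_quat_def power2_eq_square)
  then show ?thesis
    by (simp add: cmod_def norm_quat_def inner_quat_def power2_eq_square algebra_simps)
qed

lemma open_minus_Reals:
  fixes \<Omega> :: "quat set"
  assumes "open \<Omega>"
  shows "open (\<Omega> - \<real>)"
proof -
  have "closed (quat_Im -` {0})"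
    by (intro closed_vimage linear_continuous_on bounded_linear_quat_Im) simp
  moreover have "quat_Im -` {0} = \<real>"
    by (auto simp: quat_Reals_iff)
  ultimately show ?thesis
    using assms by (simp add: open_Diff)
qed

text \<open>
  A bounded factor may be discontinuous on \<open>X\<close> as long as the other one vanishes there. This is used for
  angular factors, which have no limit at real points.
\<close>

lemma continuous_on_bounded_mult_vanishing:
  fixes g w :: "'a::t2_space \<Rightarrow> 'b::real_normed_algebra"
  assumes "open (S - X)" "open S" and g: "continuous_on (S - X) g" and K: "\<And>x. norm (g x) \<le> K"
    and w: "continuous_on S w" and zero: "\<And>x. x \<in> S \<inter> X \<Longrightarrow> w x = 0"
  shows "continuous_on S (\<lambda>x. g x * w x)"
proof -
  have "isCont (\<lambda>x. g x * w x) x" if x: "x \<in> S" for x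
  proof (cases "x \<in> X")
    case False
    then show ?thesis
      using g w x assms(1,2) by (intro isCont_mult) (auto simp: continuous_on_eq_continuous_at)
  next
    case True
    have "(w \<longlongrightarrow> 0) (at x)"
      using w x zero True \<open>open S\<close> by (auto simp: continuous_on_eq_continuous_at isCont_def)
    then have "((\<lambda>y. K * norm (w y)) \<longlongrightarrow> 0) (at x)"
      by (intro tendsto_mult_right_zero tendsto_norm_zero)
    moreover have "norm (g y * w y) \<le> K * norm (w y)" for y
      using norm_mult_ineq [of "g y" "w y"] mult_right_mono [OF K norm_ge_zero] order_trans by blast
    ultimately have "((\<lambda>y. g y * w y) \<longlongrightarrow> 0) (at x)"
      by (intro Lim_null_comparison [where f = "\<lambda>y. g y * w y"]) auto
    then show ?thesis
      using zero x True by (simp add: isCont_def)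
  qed
  then show ?thesis
    by (simp add: continuous_at_imp_continuous_on)
qed

text \<open>
  Near a real point \<open>z\<close>, compare \<open>g\<close> with its linearisation at \<open>z\<close> along the vertical segment from
  \<open>y\<close> to its real part, where \<open>g\<close> vanishes. The mean value inequality for \<open>g - g' z\<close> bounds
  the error by a small multiple of \<open>\<bar>Im y\<bar>\<close>, by continuity of the derivative.
\<close>

lemma continuous_on_difference_quotient:
  fixes g :: "complex \<Rightarrow> 'b::real_normed_vector"
  assumes "open D" and g: "C1_on g D" and zero: "\<And>z. z \<in> D \<Longrightarrow> Im z = 0 \<Longrightarrow> g z = 0"
  shows "continuous_on D (\<lambda>z. if Im z = 0 then partial \<i> g z else g z /\<^sub>R Im z)"
proof -
  obtain g' :: "complex \<Rightarrow> complex \<Rightarrow>\<^sub>L 'b"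
    where g': "\<And>z. z \<in> D \<Longrightarrow> (g has_derivative blinfun_apply (g' z)) (at z)"
      and cont: "continuous_on D g'"
    using g unfolding C1_on_def by blast
  have partial: "partial \<i> g z = g' z \<i>" if "z \<in> D" for z
    by (rule partial_eq [OF g' [OF that]])
  define Q where "Q z = (if Im z = 0 then partial \<i> g z else g z /\<^sub>R Im z)" for z
  have "isCont Q z" if z: "z \<in> D" for z
  proof (cases "Im z = 0")
    case False
    have "isCont g z" "isCont Im z"
      using has_derivative_continuous [OF g' [OF z]] by (auto intro: continuous_intros)
    then have "isCont (\<lambda>z. g z /\<^sub>R Im z) z"
      using False by (intro continuous_intros)
    moreover have "\<forall>\<^sub>F y in nhds z. g y /\<^sub>R Im y = Q y"
    proof -
      have "open {y. Im y \<noteq> 0}"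
        by (intro open_Collect_neq continuous_intros)
      then have "\<forall>\<^sub>F y in nhds z. y \<in> {y. Im y \<noteq> 0}"
        using False by (intro eventually_nhds_in_open) auto
      then show ?thesis
        by eventually_elim (simp add: Q_def)
    qed
    ultimately show ?thesis
      by (simp cong: isCont_cong)
  next
    case real: True
    show ?thesis
      unfolding continuous_at_eps_delta
    proof (intro allI impI)
      fix e :: real assume "e > 0"
      have "isCont g' z"
        using cont z \<open>open D\<close> by (simp add: continuous_on_eq_continuous_at)
      then obtain d1 where d1: "d1 > 0" "\<And>y. dist y z < d1 \<Longrightarrow> dist (g' y) (g' z) < e / 2"
        unfolding continuous_at_eps_delta using \<open>e > 0\<close> by (metis half_gt_zero)
      obtain d2 where d2: "d2 > 0" "ball z d2 \<subseteq> D"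
        using \<open>open D\<close> z by (meson openE)
      define B where "B = ball z (min d1 d2)"
      have B: "y \<in> D" "norm (g' y - g' z) \<le> e / 2" if "y \<in> B" for y
        using that d1(2) [of y] d2 by (auto simp: B_def dist_commute dist_norm subset_eq)
      have "dist (Q y) (Q z) < e" if y: "y \<in> B" for y
      proof (cases "Im y = 0")
        case True
        have "norm (g' y \<i> - g' z \<i>) \<le> norm (g' y - g' z) * norm \<i>"
          by (metis minus_blinfun.rep_eq norm_blinfun)
        then have "norm (g' y \<i> - g' z \<i>) \<le> e / 2"
          using B(2) [OF y] by simp
        moreover have "Q y = g' y \<i>" "Q z = g' z \<i>"
          using True real partial [OF z] partial [OF B(1) [OF y]] by (simp_all add: Q_def)
        ultimately show ?thesis
          using \<open>e > 0\<close> by (simp add: dist_norm)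
      next
        case False
        \<comment> \<open>The foot of the vertical segment stays in the ball because \<open>z\<close> is real.\<close>
        define y0 where "y0 = complex_of_real (Re y)"
        have y0: "y0 \<in> B"
        proof -
          have "norm (z - y0) = \<bar>Re (z - y)\<bar>"
            using real by (simp add: y0_def cmod_def)
          also have "\<dots> \<le> norm (z - y)"
            by (rule abs_Re_le_cmod)
          finally show ?thesis
            using y by (simp add: B_def dist_norm)
        qed
        have "norm ((g y - g' z y) - (g y0 - g' z y0)) \<le> e / 2 * norm (y - y0)"
        proof (rule differentiable_bound [where S = B and f' = "\<lambda>x. blinfun_apply (g' x - g' z)"])
          show "((\<lambda>y. g y - g' z y) has_derivative blinfun_apply (g' x - g' z)) (at x within B)"
            if "x \<in> B" for x
            unfolding minus_blinfun.rep_eq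
            by (rule has_derivative_at_withinI, rule has_derivative_diff [OF g' [OF B(1) [OF that]]])
              (rule bounded_linear_imp_has_derivative [OF blinfun.bounded_linear_right])
          show "onorm (blinfun_apply (g' x - g' z)) \<le> e / 2" if "x \<in> B" for x
            using B(2) [OF that] by (simp add: norm_blinfun.rep_eq)
        qed (use y y0 in \<open>auto simp: B_def\<close>)
        moreover have "y - y0 = Im y *\<^sub>R \<i>"
          by (simp add: y0_def complex_eq_iff)
        moreover from this have "g' z y - g' z y0 = Im y *\<^sub>R g' z \<i>"
          by (metis blinfun.diff_right blinfun.scaleR_right)
        moreover have "g y0 = 0"
          using zero B(1) [OF y0] by (simp add: y0_def)
        ultimately have "norm (g y - Im y *\<^sub>R g' z \<i>) \<le> e / 2 * \<bar>Im y\<bar>"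
          by (simp add: algebra_simps)
        moreover have "g y - Im y *\<^sub>R g' z \<i> = Im y *\<^sub>R (Q y - Q z)"
          using False real by (simp add: Q_def partial z algebra_simps)
        ultimately have "\<bar>Im y\<bar> * norm (Q y - Q z) \<le> \<bar>Im y\<bar> * (e / 2)"
          by (simp add: mult.commute)
        then have "norm (Q y - Q z) \<le> e / 2"
          using False by simp
        then show ?thesis
          using \<open>e > 0\<close> by (simp add: dist_norm)
      qed
      then show "\<exists>d>0. \<forall>x'. dist x' z < d \<longrightarrow> dist (Q x') (Q z) < e"
        using d1 d2 by (intro exI [of _ "min d1 d2"]) (auto simp: B_def dist_commute)
    qed
  qed
  then show ?thesis
    unfolding Q_def [abs_def] by (simp add: continuous_at_imp_continuous_on)
qed

lemma has_derivative_sgn_quat_Im: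
  assumes "quat_Im x \<noteq> 0"
  defines "s \<equiv> sgn (quat_Im x)"
  shows "((\<lambda>y. sgn (quat_Im y)) has_derivative
    (\<lambda>v. (quat_Im v - (quat_Im v \<bullet> s) *\<^sub>R s) /\<^sub>R norm (quat_Im x))) (at x)"
proof -
  have Im: "(quat_Im has_derivative quat_Im) (at x)"
    by (rule bounded_linear_imp_has_derivative [OF bounded_linear_quat_Im])
  have norm: "((\<lambda>y. norm (quat_Im y)) has_derivative (\<lambda>v. quat_Im v \<bullet> s)) (at x)"
    unfolding s_def by (rule has_derivative_compose [OF Im has_derivative_norm [OF assms(1)]])
  have "((\<lambda>y. inverse (norm (quat_Im y)) *\<^sub>R quat_Im y) has_derivative
      (\<lambda>v. inverse (norm (quat_Im x)) *\<^sub>R quat_Im v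
        + (- (inverse (norm (quat_Im x)) * (quat_Im v \<bullet> s) * inverse (norm (quat_Im x)))) *\<^sub>R quat_Im x)) (at x)"
    by (rule has_derivative_scaleR [OF Deriv.has_derivative_inverse [OF _ norm] Im]) (simp add: assms(1))
  moreover have "s = quat_Im x /\<^sub>R norm (quat_Im x)"
    by (simp add: s_def sgn_quat_def)
  ultimately show ?thesis
    by (simp add: sgn_quat_def algebra_simps)
qed

lemma has_derivative_slice_param:
  assumes "quat_Im x \<noteq> 0"
  shows "(slice_param has_derivative
    (\<lambda>v. qc0 v *\<^sub>R 1 + (quat_Im v \<bullet> sgn (quat_Im x)) *\<^sub>R \<i>)) (at x)"
proof -
  have Im: "(quat_Im has_derivative quat_Im) (at x)"
    by (rule bounded_linear_imp_has_derivative [OF bounded_linear_quat_Im])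
  have Re: "(qc0 has_derivative qc0) (at x)"
    by (rule bounded_linear_imp_has_derivative [OF bounded_linear_qc0])
  have "((\<lambda>y. norm (quat_Im y)) has_derivative (\<lambda>v. quat_Im v \<bullet> sgn (quat_Im x))) (at x)"
    by (rule has_derivative_compose [OF Im has_derivative_norm [OF assms]])
  then have "((\<lambda>y. qc0 y *\<^sub>R 1 + norm (quat_Im y) *\<^sub>R \<i>) has_derivative
      (\<lambda>v. qc0 v *\<^sub>R 1 + (quat_Im v \<bullet> sgn (quat_Im x)) *\<^sub>R \<i>)) (at x)"
    by (intro has_derivative_add has_derivative_scaleR_left Re)
  moreover have "slice_param = (\<lambda>y. qc0 y *\<^sub>R 1 + norm (quat_Im y) *\<^sub>R \<i>)"
    by (simp add: fun_eq_iff complex_eq_iff)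
  ultimately show ?thesis
    by simp
qed

text \<open>
  The derivative is \<open>df\<^sub>x(v) = v Q + P\<^sub>x(v) (T + s U - Q)\<close>, where \<open>s\<close> is the direction of \<open>Im x\<close>,
  \<open>T\<close> and \<open>U\<close> are the derivatives of \<open>F\<^sub>1\<close> and \<open>F\<^sub>2\<close> in the real direction, \<open>Q\<close> is \<open>F\<^sub>2/\<beta>\<close> extended to
  the real axis, and \<open>P\<^sub>x\<close> is, for non-real \<open>x\<close>, the orthogonal projection onto the slice through \<open>x\<close>.
  At a real point all slices meet; the error in the linearisation is controlled uniformly in the
  slice, since only \<open>F\<^sub>1\<close> and \<open>F\<^sub>2\<close>
  enter and \<open>\<bar>s\<bar> \<le> 1\<close>. The last factor vanishes on the real axis, because \<open>U = 0\<close> and \<open>Q = T\<close> there.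
\<close>

lemma stem_imp_C1_on:
  assumes "open \<Omega>" "circular \<Omega>" and F: "induces \<Omega> F f"
    and C1: "C1_on (fst \<circ> F) (stem_domain \<Omega>)" "C1_on (snd \<circ> F) (stem_domain \<Omega>)"
    and ker: "\<And>z. z \<in> stem_domain \<Omega> \<Longrightarrow> stem_dzbar F z = 0"
  shows "C1_on f \<Omega>"
proof -
  define D where "D = stem_domain \<Omega>"
  define F1 where "F1 = fst \<circ> F"
  define F2 where "F2 = snd \<circ> F"
  have D: "open D" "\<And>z. z \<in> D \<Longrightarrow> cnj z \<in> D"
    using assms by (simp_all add: D_def open_stem_domain cnj_stem_domain)
  have stem: "stem_function D F"
    and f_slice: "\<And>I z. I \<in> imag_units \<Longrightarrow> z \<in> D \<Longrightarrow> f (slice_embed I z) = F1 z + I * F2 z"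
    using F by (auto simp: induces_iff [OF \<open>circular \<Omega>\<close>] D_def F1_def F2_def)
  have param_in: "slice_param x \<in> D" if "x \<in> \<Omega>" for x
    using that by (simp add: D_def slice_param_in_stem_domain_iff [OF \<open>circular \<Omega>\<close>])
  obtain d1 where d1: "\<And>z. z \<in> D \<Longrightarrow> (F1 has_derivative d1 z) (at z)"
    and cont1: "\<And>v. continuous_on D (\<lambda>z. d1 z v)"
    using C1_on_derivative [OF C1(1)] unfolding D_def F1_def by metis
  obtain d2 where d2: "\<And>z. z \<in> D \<Longrightarrow> (F2 has_derivative d2 z) (at z)"
    and cont2: "\<And>v. continuous_on D (\<lambda>z. d2 z v)"
    using C1_on_derivative [OF C1(2)] unfolding D_def F2_def by metis
  define T where "T z = d1 z 1" for z
  define U where "U z = d2 z 1" for z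
  have CR: "d1 z \<i> = - U z" "d2 z \<i> = T z" if z: "z \<in> D" for z
    using ker [of z] z stem_dzbar_eq [OF d1 [unfolded F1_def, OF z] d2 [unfolded F2_def, OF z]]
    by (simp_all add: D_def T_def U_def zero_prod_def eq_neg_iff_add_eq_0)
  have d1_eq: "d1 z (a *\<^sub>R 1 + b *\<^sub>R \<i>) = a *\<^sub>R T z - b *\<^sub>R U z"
    and d2_eq: "d2 z (a *\<^sub>R 1 + b *\<^sub>R \<i>) = a *\<^sub>R U z + b *\<^sub>R T z" if z: "z \<in> D" for z a b
  proof -
    have lin: "linear (d1 z)" "linear (d2 z)"
      using d1 [OF z] d2 [OF z] by (auto dest: has_derivative_linear)
    show "d1 z (a *\<^sub>R 1 + b *\<^sub>R \<i>) = a *\<^sub>R T z - b *\<^sub>R U z"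
      by (simp only: linear_add [OF lin(1)] linear_cmul [OF lin(1)] CR [OF z] T_def) simp
    show "d2 z (a *\<^sub>R 1 + b *\<^sub>R \<i>) = a *\<^sub>R U z + b *\<^sub>R T z"
      by (simp only: linear_add [OF lin(2)] linear_cmul [OF lin(2)] CR [OF z] U_def)
  qed
  have F2_odd: "F2 (cnj z) = (- 1) *\<^sub>R F2 z" if "z \<in> D" for z
    using stem that by (simp add: stem_function_def F2_def)
  have F2_real: "F2 z = 0" and U_real: "U z = 0" if z: "z \<in> D" "Im z = 0" for z
  proof -
    have "cnj z = z"
      using z by (simp add: complex_eq_iff)
    then have "F2 z = - F2 z" "U z = - U z"
      using F2_odd [OF z(1)] stem_derivative_cnj [OF D z(1) d2 F2_odd, of 1]
      by (simp_all add: U_def)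
    then show "F2 z = 0" "U z = 0"
      by (simp_all add: quat_eq_iff)
  qed
  define Q where "Q z = (if Im z = 0 then partial \<i> F2 z else F2 z /\<^sub>R Im z)" for z
  have cont_Q: "continuous_on D Q"
    using continuous_on_difference_quotient [OF D(1) C1(2) [folded F2_def D_def] F2_real]
    by (simp add: Q_def [abs_def])
  have Q_real: "Q z = T z" if "z \<in> D" "Im z = 0" for z
    using that partial_eq [OF d2] by (simp add: Q_def CR)

  define c where "c = slice_param"
  define s where "s x = sgn (quat_Im x)" for x
  define P where "P x v = qc0 v *\<^sub>R 1 + (quat_Im v \<bullet> s x) *\<^sub>R s x" for x v
  define f' where "f' x v = v * Q (c x) + P x v * (T (c x) + s x * U (c x) - Q (c x))" for x v
  \<comment> \<open>At real points this holds with \<open>s x = 0\<close> because \<open>F2\<close> vanishes there.\<close>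
  have f_eq: "f x = F1 (c x) + s x * F2 (c x)" if x: "x \<in> \<Omega>" for x
  proof (cases "quat_Im x = 0")
    case True
    obtain I where I: "I \<in> imag_units" "x = slice_embed I (c x)"
      unfolding c_def by (rule imag_unit_slice_param)
    have "F2 (c x) = 0"
      using True param_in [OF x] by (intro F2_real) (simp_all add: c_def)
    then show ?thesis
      using f_slice [OF I(1) param_in [OF x]] I(2) by (simp add: c_def)
  next
    case False
    then show ?thesis
      using f_slice [OF sgn_quat_Im_imag_unit [OF False] param_in [OF x]]
      by (simp add: s_def c_def slice_embed_slice_param)
  qed
  have c_in: "c ` \<Omega> \<subseteq> D" and cont_c: "continuous_on \<Omega> c"
    using param_in by (auto simp: c_def continuous_on_slice_param)
  have norm_s: "norm (s x) \<le> 1" for x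
    by (simp add: s_def norm_sgn)
  have cont_s: "continuous_on (\<Omega> - \<real>) s"
    unfolding s_def sgn_quat_def
    by (intro continuous_intros linear_continuous_on bounded_linear_quat_Im) (auto simp: quat_Reals_iff)
  have c_real: "Im (c x) = 0" if "x \<in> \<real>" for x
    using that by (simp add: c_def quat_Reals_iff)

  show ?thesis
  proof (rule C1_onI [where D = f'])
    fix x assume x: "x \<in> \<Omega>"
    then have cx: "c x \<in> D"
      using c_in by blast
    show "(f has_derivative f' x) (at x)"
    proof (cases "quat_Im x = 0")
      case False
      define dc where "dc v = qc0 v *\<^sub>R 1 + (quat_Im v \<bullet> s x) *\<^sub>R \<i>" for v
      have ss: "s x * (s x * q) = - q" for q
        unfolding s_def by (rule imag_units_mult_left [OF sgn_quat_Im_imag_unit [OF False]])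
      have dc: "(c has_derivative dc) (at x)"
        using has_derivative_slice_param [OF False] by (simp add: c_def s_def dc_def [abs_def])
      have ds: "(s has_derivative (\<lambda>v. (quat_Im v - (quat_Im v \<bullet> s x) *\<^sub>R s x) /\<^sub>R norm (quat_Im x))) (at x)"
        using has_derivative_sgn_quat_Im [OF False] by (simp add: s_def [abs_def])
      have "((\<lambda>y. F1 (c y) + s y * F2 (c y)) has_derivative (\<lambda>v. d1 (c x) (dc v) +
          (s x * d2 (c x) (dc v) + ((quat_Im v - (quat_Im v \<bullet> s x) *\<^sub>R s x) /\<^sub>R norm (quat_Im x)) * F2 (c x))))
          (at x)"
        by (intro has_derivative_add has_derivative_mult ds
          has_derivative_compose [OF dc d1 [OF cx]] has_derivative_compose [OF dc d2 [OF cx]])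
      moreover have "d1 (c x) (dc v) + (s x * d2 (c x) (dc v)
          + ((quat_Im v - (quat_Im v \<bullet> s x) *\<^sub>R s x) /\<^sub>R norm (quat_Im x)) * F2 (c x)) = f' x v" for v
      proof -
        have "v = qc0 v *\<^sub>R 1 + quat_Im v"
          by (simp add: quat_eq_iff)
        then have Im_v: "quat_Im v - (quat_Im v \<bullet> s x) *\<^sub>R s x = v - P x v"
          by (simp add: P_def algebra_simps)
        have F2_Q: "F2 (c x) /\<^sub>R norm (quat_Im x) = Q (c x)"
          using False by (simp add: Q_def c_def)
        \<comment> \<open>The Cauchy-Riemann equations make the slice part complex linear: right multiplication by \<open>T + s U\<close>.\<close>
        have along: "d1 (c x) (dc v) + s x * d2 (c x) (dc v) = P x v * (T (c x) + s x * U (c x))"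
          by (simp add: dc_def d1_eq [OF cx] d2_eq [OF cx] P_def algebra_simps ss)
        have "d1 (c x) (dc v) + (s x * d2 (c x) (dc v)
            + ((quat_Im v - (quat_Im v \<bullet> s x) *\<^sub>R s x) /\<^sub>R norm (quat_Im x)) * F2 (c x))
          = (d1 (c x) (dc v) + s x * d2 (c x) (dc v))
            + (quat_Im v - (quat_Im v \<bullet> s x) *\<^sub>R s x) * (F2 (c x) /\<^sub>R norm (quat_Im x))"
          by (simp only: add.assoc mult_scaleR_left mult_scaleR_right)
        also have "\<dots> = f' x v"
          by (simp only: Im_v F2_Q along f'_def) (simp add: algebra_simps)
        finally show ?thesis .
      qed
      ultimately have "((\<lambda>y. F1 (c y) + s y * F2 (c y)) has_derivative f' x) (at x)"
        by simp
      then show ?thesis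
        by (rule has_derivative_transform_within_open [OF _ \<open>open \<Omega>\<close> x]) (simp add: f_eq)
    next
      case real: True
      have real': "Im (c x) = 0" "s x = 0"
        using real by (simp_all add: c_def s_def)
      have f'_real: "f' x v = v * T (c x)" for v
        using Q_real [OF cx real'(1)] by (simp add: f'_def real')
      show ?thesis
        unfolding has_derivative_at_alt
      proof (intro conjI allI impI)
        show "bounded_linear (f' x)"
          unfolding f'_real [abs_def] by (rule bounded_linear_mult_left)
        fix e :: real assume "e > 0"
        then have "e / 2 > 0"
          by simp
        obtain r1 where r1: "r1 > 0" "\<And>w. norm (w - c x) < r1 \<Longrightarrow>
            norm (F1 w - F1 (c x) - d1 (c x) (w - c x)) \<le> e / 2 * norm (w - c x)"
          using d1 [OF cx] \<open>e / 2 > 0\<close> unfolding has_derivative_at_alt by metis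
        obtain r2 where r2: "r2 > 0" "\<And>w. norm (w - c x) < r2 \<Longrightarrow>
            norm (F2 w - F2 (c x) - d2 (c x) (w - c x)) \<le> e / 2 * norm (w - c x)"
          using d2 [OF cx] \<open>e / 2 > 0\<close> unfolding has_derivative_at_alt by metis
        obtain r3 where r3: "r3 > 0" "ball x r3 \<subseteq> \<Omega>"
          using \<open>open \<Omega>\<close> x by (meson openE)
        have "norm (f y - f x - f' x (y - x)) \<le> e * norm (y - x)"
          if y: "norm (y - x) < Min {r1, r2, r3}" for y
        proof -
          define \<zeta> where "\<zeta> = c y - c x"
          have Im_y: "quat_Im (y - x) = quat_Im y"
            using real by (simp add: linear_diff [OF linear_quat_Im])
          \<comment> \<open>Since \<open>x\<close> is real, the increment lies in the slice of \<open>y\<close> and its parameter has the same norm.\<close>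
          have \<zeta>: "\<zeta> = slice_param (y - x)"
            using real Im_y by (simp add: \<zeta>_def c_def complex_eq_iff)
          then have norm_\<zeta>: "norm \<zeta> = norm (y - x)"
            by (simp add: norm_slice_param)
          have "y \<in> \<Omega>"
            using y r3 by (auto simp: dist_norm norm_minus_commute)
          have "y - x = slice_embed (s y) \<zeta>"
            using slice_embed_slice_param [of "y - x"] by (simp add: Im_y s_def \<zeta>)
          then have yx: "y - x = Re \<zeta> *\<^sub>R 1 + Im \<zeta> *\<^sub>R s y"
            by (simp add: slice_embed_def quat_eq_iff)
          have "\<zeta> = Re \<zeta> *\<^sub>R 1 + Im \<zeta> *\<^sub>R \<i>"
            by (simp add: complex_eq_iff)
          then have "d1 (c x) \<zeta> = Re \<zeta> *\<^sub>R T (c x)" "d2 (c x) \<zeta> = Im \<zeta> *\<^sub>R T (c x)"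
            using d1_eq [OF cx, of "Re \<zeta>" "Im \<zeta>"] d2_eq [OF cx, of "Re \<zeta>" "Im \<zeta>"] U_real [OF cx real'(1)]
            by simp_all
          then have "d1 (c x) \<zeta> + s y * d2 (c x) \<zeta> = f' x (y - x)"
            by (simp add: f'_real yx algebra_simps)
          then have "f y - f x - f' x (y - x) =
              (F1 (c y) - F1 (c x) - d1 (c x) \<zeta>) + s y * (F2 (c y) - F2 (c x) - d2 (c x) \<zeta>)"
            using F2_real [OF cx real'(1)]
            by (simp add: f_eq [OF \<open>y \<in> \<Omega>\<close>] f_eq [OF x] algebra_simps)
          also have "norm \<dots> \<le> e / 2 * norm \<zeta> + 1 * (e / 2 * norm \<zeta>)"
          proof (intro norm_triangle_le add_mono)
            show "norm (F1 (c y) - F1 (c x) - d1 (c x) \<zeta>) \<le> e / 2 * norm \<zeta>"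
              unfolding \<zeta>_def by (rule r1(2)) (use y norm_\<zeta> \<zeta>_def in simp)
            have "norm (F2 (c y) - F2 (c x) - d2 (c x) \<zeta>) \<le> e / 2 * norm \<zeta>"
              unfolding \<zeta>_def by (rule r2(2)) (use y norm_\<zeta> \<zeta>_def in simp)
            then show "norm (s y * (F2 (c y) - F2 (c x) - d2 (c x) \<zeta>)) \<le> 1 * (e / 2 * norm \<zeta>)"
              unfolding norm_mult by (intro mult_mono norm_s) auto
          qed
          finally show ?thesis
            by (simp add: norm_\<zeta>)
        qed
        then show "\<exists>d>0. \<forall>y. norm (y - x) < d \<longrightarrow> norm (f y - f x - f' x (y - x)) \<le> e * norm (y - x)"
          using r1 r2 r3 by (intro exI [of _ "Min {r1, r2, r3}"]) auto
      qed
    qed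
  next
    fix v :: quat
    have cont: "continuous_on \<Omega> (\<lambda>x. h (c x))" if "continuous_on D h" for h :: "complex \<Rightarrow> quat"
      by (rule continuous_on_compose2 [OF that cont_c c_in])
    have off_reals: "open (\<Omega> - \<real>)"
      by (rule open_minus_Reals [OF \<open>open \<Omega>\<close>])
    have cont_sU: "continuous_on \<Omega> (\<lambda>x. s x * U (c x))"
      by (rule continuous_on_bounded_mult_vanishing [OF off_reals \<open>open \<Omega>\<close> cont_s norm_s])
        (use c_in c_real U_real in \<open>auto simp: U_def intro!: cont cont2\<close>)
    have "continuous_on \<Omega> (\<lambda>x. T (c x) + s x * U (c x) - Q (c x))"
      unfolding T_def by (intro continuous_on_add continuous_on_diff cont_sU cont cont1 cont_Q)
    moreover have "continuous_on (\<Omega> - \<real>) (\<lambda>x. P x v)"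
      unfolding P_def by (intro continuous_intros cont_s)
    moreover have "norm (P x v) \<le> \<bar>qc0 v\<bar> + norm (quat_Im v)" for x
    proof -
      have "norm ((quat_Im v \<bullet> s x) *\<^sub>R s x) \<le> norm (quat_Im v) * norm (s x) * norm (s x)"
        by (simp add: mult_right_mono Cauchy_Schwarz_ineq2)
      also have "\<dots> \<le> norm (quat_Im v)"
        using norm_s [of x] by (simp add: mult_le_one mult_left_le mult.assoc)
      finally show ?thesis
        unfolding P_def by (intro norm_triangle_le) simp
    qed
    moreover have "T (c x) + s x * U (c x) - Q (c x) = 0" if "x \<in> \<Omega> \<inter> \<real>" for x
      using that c_in c_real [of x] Q_real [of "c x"] U_real [of "c x"] by auto
    ultimately have "continuous_on \<Omega> (\<lambda>x. P x v * (T (c x) + s x * U (c x) - Q (c x)))"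
      by (intro continuous_on_bounded_mult_vanishing [OF off_reals \<open>open \<Omega>\<close>])
    then show "continuous_on \<Omega> (\<lambda>x. f' x v)"
      unfolding f'_def by (rule continuous_on_add [OF continuous_on_mult_left [OF cont [OF cont_Q]]])
  qed
qed

lemma stem_imp_slice_regular:
  assumes "open \<Omega>" "circular \<Omega>" and F: "induces \<Omega> F f"
    and C1: "C1_on (fst \<circ> F) (stem_domain \<Omega>)" "C1_on (snd \<circ> F) (stem_domain \<Omega>)"
    and ker: "\<And>z. z \<in> stem_domain \<Omega> \<Longrightarrow> stem_dzbar F z = 0"
  shows "slice_regular \<Omega> f"
  unfolding slice_regular_def
proof (intro conjI ballI)
  show "C1_on f \<Omega>"
    by (rule stem_imp_C1_on [OF assms])
  fix I x assume I: "I \<in> imag_units" and x: "x \<in> \<Omega> \<inter> slice_plane I"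
  then obtain z where x_eq: "x = slice_embed I z" and z: "z \<in> stem_domain \<Omega>"
    using slice_embed_in_circular_iff [OF \<open>circular \<Omega>\<close> I] by (auto simp: slice_plane_def)
  obtain d1 d2 where d1: "(fst \<circ> F has_derivative d1) (at z)" and d2: "(snd \<circ> F has_derivative d2) (at z)"
    using C1_on_derivative [OF C1(1)] C1_on_derivative [OF C1(2)] z by metis
  have CR: "d1 \<i> = - d2 1" "d2 \<i> = d1 1"
    using ker [OF z] stem_dzbar_eq [OF d1 d2] by (simp_all add: zero_prod_def eq_neg_iff_add_eq_0)
  have "((\<lambda>w. (fst \<circ> F) w + I * (snd \<circ> F) w) has_derivative (\<lambda>v. d1 v + I * d2 v)) (at z)"
    by (intro has_derivative_add has_derivative_mult_right d1 d2)
  then have "(f \<circ> slice_embed I has_derivative (\<lambda>v. d1 v + I * d2 v)) (at z)"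
    by (rule has_derivative_transform_within_open [OF _ open_stem_domain [OF assms(1,2)] z])
      (use F I in \<open>simp add: induces_iff [OF \<open>circular \<Omega>\<close>]\<close>)
  from dbar_slice_embed [OF I z this] show "dbar (stem_domain \<Omega>) I f x = 0"
    by (simp add: x_eq CR distrib_left right_diff_distrib imag_units_mult_left [OF I])
qed

theorem theorem2p4:
  fixes \<Omega> :: "quat set" and f :: "quat \<Rightarrow> quat"
  assumes "\<Omega> \<noteq> {}" and "open \<Omega>" and "connected \<Omega>" and "circular \<Omega>"
    and "\<Omega> \<inter> \<real> \<noteq> {}"
  shows
    "(slice_regular \<Omega> f \<longleftrightarrow>
        continuous_on \<Omega> f \<and> C1_on f (\<Omega> - \<real>) \<and> (\<forall>x \<in> \<Omega> - \<real>. theta_bar f x = 0))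
   \<and> (slice_regular \<Omega> f \<longleftrightarrow>
        C1_on f \<Omega> \<and> (\<forall>x \<in> \<Omega> - \<real>. theta_bar f x = 0))
   \<and> (slice_regular \<Omega> f \<longleftrightarrow>
        C1_on f \<Omega> \<and> (\<forall>x \<in> \<Omega>. G_op f x = 0))
   \<and> (slice_regular \<Omega> f \<longleftrightarrow>
        slice_C1 \<Omega> f \<and> (\<forall>x \<in> \<Omega>. slice_dxc \<Omega> f x = 0))"
    (is "(?a \<longleftrightarrow> ?b) \<and> (?a \<longleftrightarrow> ?c) \<and> (?a \<longleftrightarrow> ?d) \<and> (?a \<longleftrightarrow> ?e)")
proof -
  obtain a where a: "of_real a \<in> \<Omega>"
    using assms(5) by (auto elim!: Reals_cases)
  have "?a \<Longrightarrow> ?c"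
    using slice_regular_imp_theta_bar [OF \<open>circular \<Omega>\<close>] by (auto simp: slice_regular_def)
  moreover have "?c \<Longrightarrow> ?b"
    by (auto intro: C1_on_imp_continuous_on C1_on_subset)
  moreover have "?b \<Longrightarrow> ?e"
  proof -
    assume ?b
    then obtain F where F: "induces \<Omega> F f" and C1: "C1_on (fst \<circ> F) (stem_domain \<Omega>)" "C1_on (snd \<circ> F) (stem_domain \<Omega>)"
      and ker: "\<And>z. z \<in> stem_domain \<Omega> \<Longrightarrow> stem_dzbar F z = 0"
      using slice_holomorphic_imp_stem [OF assms(2-4) a] theta_bar_imp_slice_holomorphic [OF assms(2,4)]
      by metis
    then show ?e
      using slice_dxc_eq_0_iff [OF assms(2,4) F C1] by (auto simp: slice_C1_def)
  qed
  moreover have "?e \<Longrightarrow> ?a"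
  proof -
    assume e: ?e
    then obtain F where F: "induces \<Omega> F f" and C1: "C1_on (fst \<circ> F) (stem_domain \<Omega>)" "C1_on (snd \<circ> F) (stem_domain \<Omega>)"
      by (auto simp: slice_C1_def)
    then show ?a
      using e slice_dxc_eq_0_iff [OF assms(2,4) F C1] stem_imp_slice_regular [OF assms(2,4) F C1] by blast
  qed
  moreover have "?c \<longleftrightarrow> ?d"
  proof -
    have "G_op f x = 0 \<longleftrightarrow> x \<in> \<real> \<or> theta_bar f x = 0" for x
      by (cases "x \<in> \<real>") (simp_all add: G_op_Reals G_op_eq_theta_bar, simp add: quat_Reals_iff)
    then show ?thesis
      by auto
  qed
  ultimately show ?thesis
    by blast
qed

end
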